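(* Let $1\leq m\leq 3$ and $n\geq 3$. Then $\operatorname{sdepth}(I(\mathcal{C}_{n,m}))\geq \operatorname{sdepth}(S_{n,m}/I(\mathcal{C}_{n,m}))$.
   Context: $K$ is a field. For a finite simple graph $G$ whose vertices are the variables of a polynomial ring over $K$, the edge ideal $I(G)$ is the squarefree monomial ideal generated by all products $uv$ with $\{u,v\}\in E(G)$. $P_m$ is the path on $m$ vertices ($P_1$ is a single vertex with no edges) and $C_n$ ($n\ge 3$) is the cycle on $n$ vertices. The strong product $G_1\boxtimes G_2$ has vertex set $V(G_1)\times V(G_2)$, and two distinct vertices $(v_1,u_1),(v_2,u_2)$ are adjacent iff each coordinate pair is equal or adjacent ($v_1=v_2$ or $v_1v_2\in E(G_1)$, and $u_1=u_2$ or $u_1u_2\in E(G_2)$). Put $\mathcal{C}_{n,m}:=C_n\boxtimes P_m$, with vertices labelled by variables $x_{ij}$ ($1\le i\le n$, $1\le j\le m$), so that distinct $x_{ij},x_{kl}$ are adjacent iff $i-k\in\{-1,0,1\}$ modulo $n$ and $|j-l|\le 1$. $S_{n,m}:=K[x_{ij}:1\le i\le n,\ 1\le j\le m]$; $I(\mathcal{C}_{n,m})$ is an ideal of $S_{n,m}$. Stanley depth: let $S=K[x_1,\dots,x_N]$ and $M$ a finitely generated $\mathbb{Z}^N$-graded $S$-module. A Stanley decomposition $\mathcal{D}$ of $M$ is a finite direct sum of $K$-vector spaces $M=\bigoplus_{i=1}^r w_iK[A_i]$ with $w_i\in M$ homogeneous, $A_i\subseteq\{x_1,\dots,x_N\}$,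 where $w_iK[A_i]$ (the $K$-span of all $w_iu$, $u$ a monomial in $K[A_i]$) is a free $K[A_i]$-module. $\operatorname{sdepth}(\mathcal{D})=\min_i|A_i|$ and $\operatorname{sdepth}(M)$ is the maximum of $\operatorname{sdepth}(\mathcal{D})$ over all Stanley decompositions $\mathcal{D}$ of $M$. *)

theory Defs
  imports
    "HOL-Library.Poly_Mapping"
    "HOL-Algebra.QuotRing"
    "HOL-Algebra.Module"
    "Graph_Theory.Pair_Digraph"
begin

section \<open>Polynomial rings\<close>

text \<open>
  Polynomials are finitely supported functions on exponent vectors. \<open>poly_ring A\<close> is the
  subring \<open>K[A]\<close> of polynomials that involve only variables from \<open>A\<close>; the field \<open>K\<close> is the
  coefficient type.
\<close>

type_synonym 'v monom = "'v \<Rightarrow>\<^sub>0 nat"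
type_synonym ('v, 'k) mpoly = "'v monom \<Rightarrow>\<^sub>0 'k"

definition poly_ring :: "'v set \<Rightarrow> ('v, 'k::field) mpoly ring" where
  "poly_ring A =
    \<lparr> carrier = {p. \<forall>u \<in> Poly_Mapping.keys p. Poly_Mapping.keys u \<subseteq> A},
      monoid.mult = (*), one = 1, zero = 0, add = (+) \<rparr>"

definition pvar :: "'v \<Rightarrow> ('v, 'k::field) mpoly" where
  "pvar v = Poly_Mapping.single (Poly_Mapping.single v 1) 1"

text \<open>
  The elements of \<open>K[V]\<close> that are homogeneous of multidegree \<open>a\<close>: scalar multiples of the monomial
  with exponent vector \<open>a\<close> (only \<open>0\<close> if \<open>a\<close> has a negative entry or is not supported in \<open>V\<close>).
\<close>

definition homogeneous_polys :: "'v set \<Rightarrow> ('v \<Rightarrow> int) \<Rightarrow> ('v, 'k::field) mpoly set" where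
  "homogeneous_polys V a =
    {p \<in> carrier (poly_ring V).
      \<forall>u \<in> Poly_Mapping.keys p. \<forall>v. int (Poly_Mapping.lookup u v) = a v}"


section \<open>Multigraded modules\<close>

text \<open>
  A module together with its graded pieces. A multidegree is a function \<open>V \<Rightarrow> \<int>\<close>, represented as a
  function on the whole type that is zero outside \<open>V\<close>.
\<close>

record ('p, 'b, 'v) graded_module = "('p, 'b) module" +
  piece :: "('v \<Rightarrow> int) \<Rightarrow> 'b set"

definition homogeneous :: "'v set \<Rightarrow> ('p, 'b, 'v) graded_module \<Rightarrow> 'b \<Rightarrow> bool" where
  "homogeneous V M w \<longleftrightarrow> (\<exists>a. (\<forall>v. v \<notin> V \<longrightarrow> a v = 0) \<and> w \<in> piece M a)"

text \<open>
  The library's module record extends the ring record; its fields \<open>mult\<close> and \<open>one\<close> play no role in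
  the notion of a module.
\<close>

definition ideal_module ::
  "'v set \<Rightarrow> ('v, 'k::field) mpoly set \<Rightarrow> (('v, 'k) mpoly, ('v, 'k) mpoly, 'v) graded_module" where
  "ideal_module V J =
    \<lparr> carrier = J, monoid.mult = (*), one = 1, zero = 0, add = (+),
      smult = (*),
      piece = (\<lambda>a. J \<inter> homogeneous_polys V a) \<rparr>"

definition quotient_module ::
  "'v set \<Rightarrow> ('v, 'k::field) mpoly set \<Rightarrow> (('v, 'k) mpoly, ('v, 'k) mpoly set, 'v) graded_module" where
  "quotient_module V J = (let S = poly_ring V; Q = S Quot J in
    \<lparr> carrier = carrier Q, monoid.mult = monoid.mult Q, one = one Q, zero = zero Q, add = add Q,
      smult = (\<lambda>p X. (J +>\<^bsub>S\<^esub> p) \<otimes>\<^bsub>Q\<^esub> X),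
      piece = (\<lambda>a. (\<lambda>p. J +>\<^bsub>S\<^esub> p) ` homogeneous_polys V a) \<rparr>)"


section \<open>Stanley decompositions and Stanley depth\<close>

text \<open>
  \<open>w K[A]\<close>. Since \<open>K[A]\<close> is the \<open>K\<close>-span of its monomials, this is the \<open>K\<close>-span of all \<open>w u\<close> with
  \<open>u\<close> a monomial in \<open>K[A]\<close>.
\<close>

definition stanley_space ::
  "(('v, 'k::field) mpoly, 'b, 'v) graded_module \<Rightarrow> 'b \<Rightarrow> 'v set \<Rightarrow> 'b set" where
  "stanley_space M w A = (\<lambda>p. p \<odot>\<^bsub>M\<^esub> w) ` carrier (poly_ring A)"

text \<open>
  A decomposition with \<open>r\<close> summands \<open>w i K[A i]\<close>, \<open>i < r\<close>. Freeness of \<open>w i K[A i]\<close> means that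
  \<open>w i\<close> is a basis, i.e. that \<open>p \<mapsto> p w i\<close> is injective on \<open>K[A i]\<close>; in particular \<open>w i \<noteq> 0\<close>. The
  last conjunct says that \<open>M\<close> is the (internal) direct sum of the summands.
\<close>

definition stanley_decomposition ::
  "'v set \<Rightarrow> (('v, 'k::field) mpoly, 'b, 'v) graded_module \<Rightarrow>
    nat \<Rightarrow> (nat \<Rightarrow> 'b) \<Rightarrow> (nat \<Rightarrow> 'v set) \<Rightarrow> bool" where
  "stanley_decomposition V M r w A \<longleftrightarrow>
    (\<forall>i<r. w i \<in> carrier M \<and> homogeneous V M (w i) \<and> A i \<subseteq> V \<and>
           inj_on (\<lambda>p. p \<odot>\<^bsub>M\<^esub> w i) (carrier (poly_ring (A i)))) \<and>
    (\<forall>x \<in> carrier M. \<exists>!y. y \<in> (\<Pi>\<^sub>E i\<in>{..<r}. stanley_space M (w i) (A i)) \<and>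
                           x = finsum M y {..<r})"

text \<open>
  Only meaningful for \<open>M \<noteq> 0\<close> (so that \<open>r > 0\<close> below) and finite \<open>V\<close>; the maximum is then over a set
  of numbers bounded by \<open>card V\<close>.
\<close>

definition sdepth :: "'v set \<Rightarrow> (('v, 'k::field) mpoly, 'b, 'v) graded_module \<Rightarrow> nat" where
  "sdepth V M =
    Max {Min ((\<lambda>i. card (A i)) ` {..<r}) | r w A. stanley_decomposition V M r w A}"


section \<open>Graphs and edge ideals\<close>

text \<open>
  A finite simple graph is a \<^locale>\<open>pair_graph\<close>: each edge \<open>{u, v}\<close> is represented by the two arcs
  \<open>(u, v)\<close> and \<open>(v, u)\<close>.
\<close>

definition path_graph :: "nat \<Rightarrow> nat pair_pre_digraph" where
  "path_graph m =
    \<lparr> pverts = {1..m},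
      parcs = {(j, l). j \<in> {1..m} \<and> l \<in> {1..m} \<and> (l = j + 1 \<or> j = l + 1)} \<rparr>"

definition cycle_graph :: "nat \<Rightarrow> nat pair_pre_digraph" where
  "cycle_graph n =
    \<lparr> pverts = {1..n},
      parcs = {(i, k). i \<in> {1..n} \<and> k \<in> {1..n} \<and>
                       (k mod n = (i + 1) mod n \<or> i mod n = (k + 1) mod n)} \<rparr>"

definition strong_product ::
  "'a pair_pre_digraph \<Rightarrow> 'b pair_pre_digraph \<Rightarrow> ('a \<times> 'b) pair_pre_digraph" where
  "strong_product G H =
    \<lparr> pverts = pverts G \<times> pverts H,
      parcs = {((v1, u1), (v2, u2)).
        (v1, u1) \<in> pverts G \<times> pverts H \<and> (v2, u2) \<in> pverts G \<times> pverts H \<and>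
        (v1, u1) \<noteq> (v2, u2) \<and>
        (v1 = v2 \<or> (v1, v2) \<in> parcs G) \<and> (u1 = u2 \<or> (u1, u2) \<in> parcs H)} \<rparr>"

definition edge_ideal :: "'v pair_pre_digraph \<Rightarrow> ('v, 'k::field) mpoly set" where
  "edge_ideal G = Idl\<^bsub>poly_ring (pverts G)\<^esub> {pvar u * pvar v | u v. (u, v) \<in> parcs G}"

definition strong_cycle_path :: "nat \<Rightarrow> nat \<Rightarrow> (nat \<times> nat) pair_pre_digraph" where
  "strong_cycle_path n m = strong_product (cycle_graph n) (path_graph m)"


section \<open>Consistency checks\<close>

lemma cring_poly_ring: "cring (poly_ring A :: ('v,'k::field) mpoly ring)"
proof (intro cringI abelian_groupI comm_monoidI)
  fix x y :: "('v,'k) mpoly"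
  assume x: "x \<in> carrier (poly_ring A)" and y: "y \<in> carrier (poly_ring A)"
  show "x \<oplus>\<^bsub>poly_ring A\<^esub> y \<in> carrier (poly_ring A)"
    using x y Poly_Mapping.keys_add[of x y] by (auto simp: poly_ring_def)
  { fix u assume "u \<in> Poly_Mapping.keys (x * y)"
    then obtain a b where "u = a + b" "a \<in> Poly_Mapping.keys x" "b \<in> Poly_Mapping.keys y"
      using Poly_Mapping.keys_mult[of x y] by blast
    moreover have "Poly_Mapping.keys a \<subseteq> A" "Poly_Mapping.keys b \<subseteq> A"
      using x y calculation by (auto simp: poly_ring_def)
    ultimately have "Poly_Mapping.keys u \<subseteq> A"
      using Poly_Mapping.keys_add[of a b] by blast }
  then show "x \<otimes>\<^bsub>poly_ring A\<^esub> y \<in> carrier (poly_ring A)"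
    by (auto simp: poly_ring_def)
  show "\<exists>z\<in>carrier (poly_ring A). z \<oplus>\<^bsub>poly_ring A\<^esub> x = \<zero>\<^bsub>poly_ring A\<^esub>"
    by (rule bexI[of _ "-x"]) (use x in \<open>auto simp: poly_ring_def\<close>)
qed (auto simp: poly_ring_def algebra_simps)

lemma pair_graph_strong_cycle_path:
  assumes "n \<ge> 3" shows "pair_graph (strong_cycle_path n m)"
proof
  show "finite (parcs (strong_cycle_path n m))"
    by (rule finite_subset[of _ "({1..n}\<times>{1..m})\<times>({1..n}\<times>{1..m})"])
       (auto simp: strong_cycle_path_def strong_product_def cycle_graph_def path_graph_def)
  show "symmetric (strong_cycle_path n m)"
    by (auto simp: symmetric_def sym_def strong_cycle_path_def strong_product_def cycle_graph_def path_graph_def)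
qed (auto simp: strong_cycle_path_def strong_product_def cycle_graph_def path_graph_def)

lemma adjacent_strong_cycle_path_iff:
  assumes "n \<ge> 3"
  shows "((i,j),(k,l)) \<in> parcs (strong_cycle_path n m) \<longleftrightarrow>
    i \<in> {1..n} \<and> k \<in> {1..n} \<and> j \<in> {1..m} \<and> l \<in> {1..m} \<and> (i,j) \<noteq> (k,l) \<and>
    (\<exists>d\<in>{-1,0,1}. (int i - int k) mod int n = d mod int n) \<and> \<bar>int j - int l\<bar> \<le> 1"
proof -
  have c: "((i,k) \<in> parcs (cycle_graph n) \<or> i = k) \<longleftrightarrow> (\<exists>d\<in>{-1,0,1}. (int i - int k) mod int n = d mod int n)"
    if "i \<in> {1..n}" "k \<in> {1..n}"
  proof -
    have 0: "(int i - int k) mod int n = 0 mod int n \<longleftrightarrow> i = k"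
    proof
      assume "(int i - int k) mod int n = 0 mod int n"
      then have "int n dvd int i - int k" by auto
      moreover have "\<bar>int i - int k\<bar> < int n" using that by auto
      ultimately show "i = k" using zdvd_not_zless[of "\<bar>int i - int k\<bar>" "int n"] by (cases "i = k") auto
    qed auto
    have 1: "(int i - int k) mod int n = 1 mod int n \<longleftrightarrow> i mod n = (k+1) mod n"
    proof -
      have "i mod n = (k+1) mod n \<longleftrightarrow> int i mod int n = (int k + 1) mod int n"
        by (metis of_nat_1 of_nat_add of_nat_eq_iff zmod_int)
      also have "\<dots> \<longleftrightarrow> int n dvd (int i - int k) - 1"
        by (simp add: mod_eq_dvd_iff algebra_simps)
      finally show ?thesis by (simp add: mod_eq_dvd_iff)
    qed
    have 2: "(int i - int k) mod int n = (-1) mod int n \<longleftrightarrow> k mod n = (i+1) mod n"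
    proof -
      have "k mod n = (i+1) mod n \<longleftrightarrow> int k mod int n = (int i + 1) mod int n"
        by (metis of_nat_1 of_nat_add of_nat_eq_iff zmod_int)
      also have "\<dots> \<longleftrightarrow> int n dvd int k - (int i + 1)" by (simp add: mod_eq_dvd_iff)
      also have "\<dots> \<longleftrightarrow> int n dvd (int i - int k) - (-1)"
        by (subst dvd_minus_iff[symmetric]) (simp add: algebra_simps)
      finally show ?thesis by (simp add: mod_eq_dvd_iff)
    qed
    show ?thesis using that 0 1 2 by (auto simp: cycle_graph_def)
  qed
  show ?thesis using c by (auto simp: strong_cycle_path_def strong_product_def path_graph_def cycle_graph_def)
qed

lemma ideal_edge_ideal:
  assumes "pair_graph G"
  shows "ideal (edge_ideal G :: ('v,'k::field) mpoly set) (poly_ring (pverts G))"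
proof -
  interpret cring "poly_ring (pverts G) :: ('v,'k) mpoly ring" by (rule cring_poly_ring)
  interpret pair_graph G by fact
  have v: "pvar v \<in> carrier (poly_ring (pverts G))" if "v \<in> pverts G" for v
    using that by (auto simp: pvar_def poly_ring_def)
  show ?thesis unfolding edge_ideal_def
  proof (rule genideal_ideal, safe)
    fix u v assume "(u,v) \<in> parcs G"
    then have "u \<in> pverts G" "v \<in> pverts G" by (auto dest: in_arcsD1 in_arcsD2)
    from m_closed[OF v[OF this(1)] v[OF this(2)]]
    show "pvar u * pvar v \<in> carrier (poly_ring (pverts G) :: ('v,'k) mpoly ring)" by (simp add: poly_ring_def)
  qed
qed

lemma module_ideal_module: assumes "ideal J (poly_ring V)"
  shows "Module.module (poly_ring V) (ideal_module V J)"
proof -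
  interpret ideal J "poly_ring V" by fact
  note c = cring_poly_ring[of V]
  have s: "x \<in> J \<Longrightarrow> x \<in> carrier (poly_ring V)" for x using a_subset by auto
  have ops: "add (poly_ring V) = (+)" "monoid.mult (poly_ring V) = (*)"
      "\<zero>\<^bsub>poly_ring V\<^esub> = 0" "\<one>\<^bsub>poly_ring V\<^esub> = 1"
    by (simp_all add: poly_ring_def)
  have cl: "x + y \<in> J" if "x \<in> J" "y \<in> J" for x y
    using that additive_subgroup.a_closed[OF is_additive_subgroup, of x y] by (simp add: ops)
  have cs: "p * x \<in> J" if "x \<in> J" "p \<in> carrier (poly_ring V)" for x p
    using that I_l_closed[of x p] by (simp add: ops)
  have z: "0 \<in> J"
    using additive_subgroup.zero_closed[OF is_additive_subgroup] by (simp add: ops)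
  show ?thesis
  proof (rule moduleI[OF c], rule abelian_groupI)
    fix x assume "x \<in> carrier (ideal_module V J)"
    then have "x \<in> J" by (simp add: ideal_module_def)
    then have "\<ominus>\<^bsub>poly_ring V\<^esub> x \<in> J" "\<ominus>\<^bsub>poly_ring V\<^esub> x \<oplus>\<^bsub>poly_ring V\<^esub> x = \<zero>\<^bsub>poly_ring V\<^esub>" using s by (auto simp: l_neg)
    then show "\<exists>y\<in>carrier (ideal_module V J). y \<oplus>\<^bsub>ideal_module V J\<^esub> x = \<zero>\<^bsub>ideal_module V J\<^esub>"
      by (auto simp: ideal_module_def poly_ring_def)
  qed (simp_all add: ideal_module_def ops cl cs z distrib_left distrib_right ac_simps)
qed

lemma module_quotient_module:
  fixes V :: "'v set" assumes "ideal (J::('v,'k::field) mpoly set) (poly_ring V)"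
  shows "Module.module (poly_ring V) (quotient_module V J)"
proof -
  interpret ideal J "poly_ring V" by fact
  interpret Q: ring "poly_ring V Quot J" by (rule quotient_is_ring)
  interpret h: ring_hom_ring "poly_ring V" "poly_ring V Quot J" "(+>\<^bsub>poly_ring V\<^esub>) J" by (rule rcos_ring_hom_ring)
  note c = cring_poly_ring[of V]
  have o: "\<one>\<^bsub>poly_ring V Quot J\<^esub> = J +>\<^bsub>poly_ring V\<^esub> \<one>\<^bsub>poly_ring V\<^esub>" by simp
  note d = quotient_module_def Let_def
  show ?thesis
  proof (rule moduleI[OF c], rule abelian_groupI)
    fix x assume "x \<in> carrier (quotient_module V J)"
    then show "\<exists>y\<in>carrier (quotient_module V J). y \<oplus>\<^bsub>quotient_module V J\<^esub> x = \<zero>\<^bsub>quotient_module V J\<^esub>"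
      by (intro bexI[of _ "\<ominus>\<^bsub>poly_ring V Quot J\<^esub> x"]) (simp_all add: d Q.l_neg)
  qed (simp_all add: d Q.a_ac Q.l_distr Q.r_distr Q.m_assoc flip: o)
qed

end

theory Submission
  imports Defs "HOL-Library.Disjoint_Sets"
begin

text \<open>
  Write \<open>G\<close> for the strong product of the cycle and the path, and \<open>I\<close> for its edge ideal. The two
  Stanley depths are separated by the number \<open>\<lceil>n / 3\<rceil>\<close>; each of the two bounds is an instance of a
  statement about arbitrary finite simple graphs.

  Upper bound for the quotient (\<open>sdepth_quotient_le\<close>): if \<open>F\<close> is an independent dominating set, then
  \<open>sdepth (S / I) \<le> card F\<close>. The monomial \<open>\<Prod>v\<in>F. v ^ t\<close> is not in \<open>I\<close>, so it has a nonzero component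
  in some summand \<open>w K[A]\<close> of a given decomposition. If \<open>t\<close> exceeds all degrees of the generators,
  then each variable of \<open>F\<close> has to be contributed by \<open>K[A]\<close>, that is \<open>F \<subseteq> A\<close>. Conversely a vertex \<open>v \<in> A - F\<close> has a
  neighbour \<open>f \<in> F \<subseteq> A\<close>, and \<open>f v\<close> would annihilate \<open>w\<close>, against freeness. Hence \<open>A = F\<close>.

  Lower bound for the ideal (\<open>sdepth_edge_ideal_ge\<close>): if the closed neighbourhoods of the vertices in
  \<open>C\<close> are pairwise disjoint and \<open>G\<close> has an edge, then \<open>sdepth I \<ge> card C + 1\<close>. A monomial lies in \<open>I\<close>
  iff its support contains an edge, and a partition of the family of these supports into intervals
  \<open>[B, A]\<close> yields the Stanley decomposition with summands \<open>x\<^sup>B K[A]\<close>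
  (\<open>stanley_decomposition_of_intervals\<close>). Such a partition with \<open>card A > card C\<close> throughout is built
  by induction on the number of vertices, removing one vertex outside \<open>C\<close> at a time
  (\<open>dependent_sets_partitionable\<close>).

  For \<open>m \<le> 3\<close> one row of the product dominates all rows, so taking every third vertex of it gives an
  independent dominating set of size \<open>\<lceil>n / 3\<rceil>\<close>. Every third vertex of a row also gives \<open>\<lfloor>n / 3\<rfloor>\<close>
  disjoint closed neighbourhoods. The theorem follows from \<open>\<lceil>n / 3\<rceil> \<le> \<lfloor>n / 3\<rfloor> + 1\<close>.
\<close>

section \<open>Interval partitions of families of sets\<close>

text \<open>
  The blocks are intervals of the subset lattice; \<open>k\<close> bounds the sizes of their top elements, which
  become the dimensions of the summands of a Stanley decomposition.
\<close>

definition interval_partitionable :: "'v set set \<Rightarrow> nat \<Rightarrow> bool" where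
  "interval_partitionable \<F> k \<longleftrightarrow>
    (\<exists>P. finite P \<and> partition_on \<F> P \<and>
      (\<forall>X\<in>P. \<exists>B A. X = {B..A} \<and> B \<subseteq> A \<and> finite A \<and> k \<le> card A))"

lemma interval_partitionable_empty: "interval_partitionable {} k"
  unfolding interval_partitionable_def by (rule exI[of _ "{}"]) (simp add: partition_on_empty)

lemma interval_partitionable_interval:
  assumes "B \<subseteq> A" "finite A" "k \<le> card A"
  shows "interval_partitionable {B..A} k"
  unfolding interval_partitionable_def
  using assms by (intro exI[of _ "{{B..A}}"]) (auto intro!: partition_on_space)

lemma interval_partitionable_mono:
  "interval_partitionable \<F> k \<Longrightarrow> l \<le> k \<Longrightarrow> interval_partitionable \<F> l"
  unfolding interval_partitionable_def by (meson order_trans)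

lemma interval_partitionable_Un:
  assumes "interval_partitionable \<F> k" "interval_partitionable \<G> k" "\<F> \<inter> \<G> = {}"
  shows "interval_partitionable (\<F> \<union> \<G>) k"
proof -
  let ?iv = "\<lambda>X. \<exists>B A. X = {B..A} \<and> B \<subseteq> A \<and> finite A \<and> k \<le> card A"
  from assms obtain P Q where P: "finite P" "partition_on \<F> P" "\<forall>X\<in>P. ?iv X"
    and Q: "finite Q" "partition_on \<G> Q" "\<forall>X\<in>Q. ?iv X"
    unfolding interval_partitionable_def by blast
  have "partition_on (\<F> \<union> \<G>) (P \<union> Q)"
    using P(2) Q(2) assms(3) unfolding partition_on_def
    by (auto intro!: disjoint_union)
  then show ?thesis
    unfolding interval_partitionable_def using P Q by (intro exI[of _ "P \<union> Q"]) auto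
qed

lemma insert_image_interval:
  assumes "r \<notin> A" "B \<subseteq> A"
  shows "insert r ` {B..A} = {insert r B..insert r A}"
proof (intro equalityI subsetI)
  fix T assume T: "T \<in> {insert r B..insert r A}"
  then have "T = insert r (T - {r})" by auto
  moreover have "T - {r} \<in> {B..A}" using T assms by auto
  ultimately show "T \<in> insert r ` {B..A}" by (rule image_eqI)
qed auto

lemma interval_partitionable_insert:
  assumes "interval_partitionable \<F> k" "\<And>T. T \<in> \<F> \<Longrightarrow> r \<notin> T"
  shows "interval_partitionable (insert r ` \<F>) (Suc k)"
proof -
  from assms obtain P where P: "finite P" "partition_on \<F> P"
    and iv: "\<forall>X\<in>P. \<exists>B A. X = {B..A} \<and> B \<subseteq> A \<and> finite A \<and> k \<le> card A"
    unfolding interval_partitionable_def by blast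
  have inj: "inj_on (insert r) \<F>"
    using assms(2) by (metis inj_onI insert_ident)
  have "\<exists>B A. insert r ` X = {B..A} \<and> B \<subseteq> A \<and> finite A \<and> Suc k \<le> card A" if "X \<in> P" for X
  proof -
    from iv that obtain B A where BA: "X = {B..A}" "B \<subseteq> A" "finite A" "k \<le> card A" by blast
    have "A \<in> \<F>" using P(2) that BA by (auto simp: partition_on_def)
    then have "r \<notin> A" by (rule assms(2))
    with BA show ?thesis
      by (intro exI[of _ "insert r B"] exI[of _ "insert r A"]) (auto simp: insert_image_interval)
  qed
  moreover have "partition_on (insert r ` \<F>) ((`) (insert r) ` P)"
  proof -
    have "{} \<notin> (`) (insert r) ` P" using P(2) by (auto simp: partition_on_def)
    then show ?thesis using partition_on_inj_image[OF P(2) inj] by simp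
  qed
  ultimately show ?thesis
    unfolding interval_partitionable_def using P(1)
    by (intro exI[of _ "(`) (insert r) ` P"]) auto
qed

text \<open>
  Sort the sets by the first element of \<open>Y\<close> (in some enumeration \<open>y\<^sub>1, y\<^sub>2, \<dots>\<close>) that they contain:
  those with first element \<open>y\<^sub>i\<close> form an interval with bottom \<open>{y\<^sub>i}\<close> whose top omits only the earlier
  \<open>y\<close>'s. So all tops contain \<open>V - Y\<close> and one further element.
\<close>

lemma interval_partitionable_meeting:
  assumes "finite V" "Y \<subseteq> V"
  shows "interval_partitionable {T. T \<subseteq> V \<and> T \<inter> Y \<noteq> {}} (Suc (card (V - Y)))"
proof -
  have "finite Y" using assms by (rule finite_subset[rotated])
  from this assms show ?thesis
  proof (induction Y arbitrary: V rule: finite_induct)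
    case empty
    then show ?case by (simp add: interval_partitionable_empty)
  next
    case (insert y Y)
    have *: "(V - {y}) - Y = V - insert y Y" by auto
    have "interval_partitionable {T. T \<subseteq> V - {y} \<and> T \<inter> Y \<noteq> {}} (Suc (card (V - insert y Y)))"
      using insert.IH[of "V - {y}"] insert.prems insert.hyps unfolding * by auto
    moreover have "interval_partitionable {{y}..V} (Suc (card (V - insert y Y)))"
      using insert.prems by (intro interval_partitionable_interval) (auto simp: Suc_le_eq intro!: psubset_card_mono)
    moreover have "{T. T \<subseteq> V \<and> T \<inter> insert y Y \<noteq> {}} = {T. T \<subseteq> V - {y} \<and> T \<inter> Y \<noteq> {}} \<union> {{y}..V}"
    proof (intro Set.set_eqI)
      show "T \<in> {T. T \<subseteq> V \<and> T \<inter> insert y Y \<noteq> {}} \<longleftrightarrow> T \<in> {T. T \<subseteq> V - {y} \<and> T \<inter> Y \<noteq> {}} \<union> {{y}..V}" for T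
        by (cases "y \<in> T") (auto simp: subset_Diff_insert)
    qed
    moreover have "{T. T \<subseteq> V - {y} \<and> T \<inter> Y \<noteq> {}} \<inter> {{y}..V} = {}" by auto
    ultimately show ?case by (simp only: interval_partitionable_Un)
  qed
qed

text \<open>
  The supports of the monomials of the edge ideal of the graph with vertex set \<open>V\<close> and arcs \<open>E\<close>.
\<close>

definition dependent_sets :: "'v set \<Rightarrow> 'v rel \<Rightarrow> 'v set set" where
  "dependent_sets V E = {T. T \<subseteq> V \<and> (\<exists>x\<in>T. \<exists>y\<in>T. (x, y) \<in> E)}"

text \<open>
  If a set contains \<open>r\<close> but no neighbour of \<open>r\<close>, its edges avoid \<open>r\<close>, so it is dependent because of an
  edge between two non-neighbours of \<open>r\<close>. If it contains \<open>r\<close> and a neighbour, it is always dependent.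
\<close>

lemma dependent_sets_split:
  assumes "sym E" "(r, r) \<notin> E" "r \<in> V"
  shows "dependent_sets V E = dependent_sets (V - {r}) E \<union>
    (insert r ` {T. T \<subseteq> V - {r} \<and> T \<inter> (E `` {r} \<inter> (V - {r})) \<noteq> {}} \<union>
     insert r ` dependent_sets (V - {r} - E `` {r}) E)" (is "?L = ?R")
proof (intro equalityI subsetI)
  fix T assume T: "T \<in> ?L"
  then have "T = insert r (T - {r})" if "r \<in> T" using that by auto
  moreover have "T - {r} \<in> {T. T \<subseteq> V - {r} \<and> T \<inter> (E `` {r} \<inter> (V - {r})) \<noteq> {}} \<union> dependent_sets (V - {r} - E `` {r}) E"
    if "r \<in> T"
    using T that assms(1,2) unfolding dependent_sets_def sym_def by blast
  ultimately show "T \<in> ?R"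
    using T by (cases "r \<in> T") (blast, auto simp: dependent_sets_def)
qed (use assms in \<open>auto simp: dependent_sets_def sym_def\<close>)

text \<open>
  Induction on \<open>card V\<close>. If \<open>V = C\<close>, the graph has no edges and there is nothing to partition.
  Otherwise split at a vertex \<open>r\<close> outside \<open>C\<close>. The sets that avoid \<open>r\<close> are covered by the induction
  hypothesis for \<open>V - {r}\<close> and the same \<open>C\<close>. For the sets that contain \<open>r\<close>, the decisive point is that
  \<open>r\<close> has at most one neighbour in \<open>C\<close>: passing to the non-neighbours of \<open>r\<close> costs at most one element
  of \<open>C\<close>, and \<open>r\<close> itself compensates for it. The surplus of one over \<open>card C\<close> comes from the sets that
  contain \<open>r\<close> and a neighbour of \<open>r\<close>: there the tops contain \<open>r\<close>, a neighbour, and all non-neighbours.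
\<close>

lemma dependent_sets_partitionable:
  fixes E :: "'v rel"
  assumes "finite V" "sym E" "irrefl E" "C \<subseteq> V" "disjoint_family_on (\<lambda>c. insert c (E `` {c})) C"
  shows "interval_partitionable (dependent_sets V E) (Suc (card C))"
  using assms(1,4,5)
proof (induction "card V" arbitrary: V C rule: less_induct)
  case less
  have packing: "c \<notin> insert d (E `` {d})" "\<not> (x \<in> E `` {c} \<and> x \<in> E `` {d})"
    if "c \<in> C" "d \<in> C" "c \<noteq> d" for c d x
    using less.prems(3) that unfolding disjoint_family_on_def by blast+
  show ?case
  proof (cases "V = C")
    case True
    have "dependent_sets V E = {}"
      using packing assms(3) unfolding True dependent_sets_def irrefl_def by blast
    then show ?thesis by (simp add: interval_partitionable_empty)
  next
    case False
    then obtain r where r: "r \<in> V" "r \<notin> C" using less.prems by auto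
    define Y where "Y = E `` {r} \<inter> (V - {r})"
    let ?W = "V - {r} - E `` {r}"
    have W: "?W = (V - {r}) - Y" by (auto simp: Y_def)
    have smaller: "card (V - {r}) < card V" "card ?W < card V"
      using r less.prems(1) by (blast intro!: psubset_card_mono)+
    have finC: "finite C" using less.prems finite_subset by blast
    have "\<exists>c. C \<inter> E `` {r} \<subseteq> {c}"
      using packing(2)[of _ _ r] assms(2) unfolding sym_def by blast
    then have "card (C \<inter> E `` {r}) \<le> 1"
      by (metis card.empty card_insert_disjoint card_mono empty_iff finite.emptyI finite.insertI One_nat_def)
    then have C': "card C \<le> Suc (card (C - E `` {r}))"
      using card_Diff_subset_Int[of C "E `` {r}"] finC by simp
    have CW: "C - E `` {r} \<subseteq> ?W" using less.prems(2) r by auto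
    then have "card C \<le> Suc (card ?W)"
      using C' card_mono[OF _ CW] less.prems(1) by force
    then have "interval_partitionable {T. T \<subseteq> V - {r} \<and> T \<inter> Y \<noteq> {}} (card C)"
      unfolding W by (intro interval_partitionable_mono[OF interval_partitionable_meeting])
        (use less.prems(1) in \<open>auto simp: Y_def\<close>)
    then have 1: "interval_partitionable (insert r ` {T. T \<subseteq> V - {r} \<and> T \<inter> Y \<noteq> {}}) (Suc (card C))"
      by (rule interval_partitionable_insert) auto
    have "interval_partitionable (dependent_sets ?W E) (Suc (card (C - E `` {r})))"
      using less.prems smaller CW
      by (intro less.hyps) (auto intro: disjoint_family_on_mono[rotated])
    then have "interval_partitionable (dependent_sets ?W E) (card C)"
      using C' by (rule interval_partitionable_mono)
    then have 2: "interval_partitionable (insert r ` dependent_sets ?W E) (Suc (card C))"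
      by (rule interval_partitionable_insert) (auto simp: dependent_sets_def)
    have 3: "interval_partitionable (dependent_sets (V - {r}) E) (Suc (card C))"
      using less.prems smaller r by (intro less.hyps) auto
    have irrefl_r: "(r, r) \<notin> E" using assms(3) by (auto simp: irrefl_def)
    let ?meet = "insert r ` {T. T \<subseteq> V - {r} \<and> T \<inter> Y \<noteq> {}}"
    let ?avoid = "insert r ` dependent_sets ?W E"
    have "S \<inter> E `` {r} \<noteq> {}" if "S \<in> ?meet" for S
      using that by (auto simp: Y_def)
    moreover have "S \<inter> E `` {r} = {}" if "S \<in> ?avoid" for S
      using that irrefl_r by (auto simp: dependent_sets_def)
    ultimately have "?meet \<inter> ?avoid = {}" by blast
    moreover have "dependent_sets (V - {r}) E \<inter> (?meet \<union> ?avoid) = {}"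
      by (auto simp: dependent_sets_def)
    ultimately have "interval_partitionable (dependent_sets (V - {r}) E \<union> (?meet \<union> ?avoid)) (Suc (card C))"
      by (intro interval_partitionable_Un 1 2 3)
    then show ?thesis
      using dependent_sets_split[OF assms(2) irrefl_r r(1)] by (simp only: Y_def)
  qed
qed

section \<open>Polynomials with prescribed monomial supports\<close>

text \<open>
  The span of all monomials whose set of variables belongs to \<open>\<F>\<close>. Polynomial rings in fewer
  variables, squarefree monomial ideals and Stanley spaces \<open>x\<^sup>B K[A]\<close> all have this form.
\<close>

definition supported :: "'v set set \<Rightarrow> ('v, 'k::field) mpoly set" where
  "supported \<F> = {p. \<forall>u\<in>Poly_Mapping.keys p. Poly_Mapping.keys u \<in> \<F>}"

definition restriction :: "'v set set \<Rightarrow> ('v, 'k::field) mpoly \<Rightarrow> ('v, 'k) mpoly" where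
  "restriction \<F> p =
    (\<Sum>u\<in>{u\<in>Poly_Mapping.keys p. Poly_Mapping.keys u \<in> \<F>}. Poly_Mapping.single u (Poly_Mapping.lookup p u))"

text \<open>
  The exponent vector of \<open>\<Prod>v\<in>F. v ^ t\<close>.
\<close>

definition power_exponent :: "'v set \<Rightarrow> nat \<Rightarrow> 'v monom" where
  "power_exponent F t = (\<Sum>v\<in>F. Poly_Mapping.single v t)"

definition squarefree_monomial :: "'v set \<Rightarrow> ('v, 'k::field) mpoly" where
  "squarefree_monomial B = Poly_Mapping.single (power_exponent B 1) 1"

lemma carrier_poly_ring: "carrier (poly_ring A) = supported (Pow A)"
  by (auto simp: poly_ring_def supported_def)

lemma poly_ring_simps [simp]:
  "add (poly_ring A) = (+)" "monoid.mult (poly_ring A) = (*)"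
  "\<zero>\<^bsub>poly_ring A\<^esub> = 0" "\<one>\<^bsub>poly_ring A\<^esub> = 1"
  by (simp_all add: poly_ring_def)

lemma supported_mono: "\<F> \<subseteq> \<G> \<Longrightarrow> supported \<F> \<subseteq> supported \<G>"
  by (auto simp: supported_def)

lemma supported_iff_lookup:
  "p \<in> supported \<F> \<longleftrightarrow> (\<forall>u. Poly_Mapping.keys u \<notin> \<F> \<longrightarrow> Poly_Mapping.lookup p u = 0)"
  by (auto simp: supported_def in_keys_iff)

lemma supported_zero [simp]: "0 \<in> supported \<F>"
  by (simp add: supported_def)

lemma supported_add: "p \<in> supported \<F> \<Longrightarrow> q \<in> supported \<F> \<Longrightarrow> p + q \<in> supported \<F>"
  by (simp add: supported_iff_lookup lookup_add)

lemma supported_diff: "p \<in> supported \<F> \<Longrightarrow> q \<in> supported \<F> \<Longrightarrow> p - q \<in> supported \<F>"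
  by (simp add: supported_iff_lookup lookup_minus)

lemma supported_sum: "(\<And>i. i \<in> X \<Longrightarrow> f i \<in> supported \<F>) \<Longrightarrow> sum f X \<in> supported \<F>"
  by (simp add: supported_iff_lookup lookup_sum)

lemma lookup_restriction:
  "Poly_Mapping.lookup (restriction \<F> p) u = (if Poly_Mapping.keys u \<in> \<F> then Poly_Mapping.lookup p u else 0)"
proof -
  have "Poly_Mapping.lookup (restriction \<F> p) u =
    (\<Sum>v\<in>{v\<in>Poly_Mapping.keys p. Poly_Mapping.keys v \<in> \<F>}. if v = u then Poly_Mapping.lookup p v else 0)"
    unfolding restriction_def lookup_sum by (simp add: lookup_single when_def)
  also have "\<dots> = (if Poly_Mapping.keys u \<in> \<F> then Poly_Mapping.lookup p u else 0)"
    by (subst sum.delta) (auto simp: in_keys_iff)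
  finally show ?thesis .
qed

lemma restriction_supported: "restriction \<F> p \<in> supported \<F>"
  by (simp add: supported_iff_lookup lookup_restriction)

lemma restriction_id:
  assumes "p \<in> supported \<F>" shows "restriction \<F> p = p"
  by (rule poly_mapping_eqI) (use assms in \<open>auto simp: lookup_restriction supported_iff_lookup\<close>)

lemma sum_monomials: "(\<Sum>u\<in>Poly_Mapping.keys p. Poly_Mapping.single u (Poly_Mapping.lookup p u)) = (p :: ('v, 'k::field) mpoly)"
  using restriction_id[of p UNIV] by (simp add: restriction_def supported_def)

lemma keys_add_monom: "Poly_Mapping.keys (u + v :: 'v monom) = Poly_Mapping.keys u \<union> Poly_Mapping.keys v"
  by (auto simp: in_keys_iff lookup_add)

lemma lookup_power_exponent:
  assumes "finite F" shows "Poly_Mapping.lookup (power_exponent F t) v = (if v \<in> F then t else 0)"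
  unfolding power_exponent_def lookup_sum using assms by (simp add: lookup_single when_def)

lemma keys_power_exponent:
  assumes "finite F" "0 < t" shows "Poly_Mapping.keys (power_exponent F t) = F"
  using assms by (auto simp: in_keys_iff lookup_power_exponent split: if_splits)

lemma keys_mult_single:
  fixes p :: "('v, 'k::field) mpoly"
  assumes "u \<in> Poly_Mapping.keys (p * Poly_Mapping.single m c)"
  obtains v where "v \<in> Poly_Mapping.keys p" "u = v + m"
  using keys_mult[of p "Poly_Mapping.single m c"] assms by (auto split: if_splits)

text \<open>
  Multiplication by a monomial merely shifts the coefficients; the freeness of the Stanley spaces
  \<open>x\<^sup>B K[A]\<close> rests on this.
\<close>

lemma lookup_mult_single:
  fixes p :: "('v, 'k::field) mpoly"
  shows "Poly_Mapping.lookup (p * Poly_Mapping.single m c) (u + m) = Poly_Mapping.lookup p u * c"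
proof -
  have "p * Poly_Mapping.single m c =
      (\<Sum>v\<in>Poly_Mapping.keys p. Poly_Mapping.single (v + m) (Poly_Mapping.lookup p v * c))"
    by (subst sum_monomials[of p, symmetric]) (simp add: sum_distrib_right mult_single)
  then have "Poly_Mapping.lookup (p * Poly_Mapping.single m c) (u + m) =
      (\<Sum>v\<in>Poly_Mapping.keys p. if v = u then Poly_Mapping.lookup p v * c else 0)"
    by (simp add: lookup_sum lookup_single when_def)
  also have "\<dots> = Poly_Mapping.lookup p u * c"
    by (subst sum.delta) (auto simp: in_keys_iff)
  finally show ?thesis .
qed

lemma inj_mult_squarefree_monomial:
  "inj (\<lambda>p. p * squarefree_monomial B :: ('v, 'k::field) mpoly)"
proof (rule injI, rule poly_mapping_eqI)
  fix p q :: "('v, 'k) mpoly" and u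
  assume "p * squarefree_monomial B = q * squarefree_monomial B"
  then show "Poly_Mapping.lookup p u = Poly_Mapping.lookup q u"
    using lookup_mult_single[of p "power_exponent B 1" 1 u] lookup_mult_single[of q "power_exponent B 1" 1 u]
    by (simp add: squarefree_monomial_def)
qed

text \<open>
  A monomial lies in \<open>x\<^sup>B K[A]\<close> iff its support is between \<open>B\<close> and \<open>A\<close>. The exponents at \<open>B\<close> may be
  arbitrary positive numbers because \<open>B \<subseteq> A\<close>.
\<close>

lemma supported_interval:
  assumes "finite A" "B \<subseteq> A"
  shows "supported {B..A} = (\<lambda>p. p * squarefree_monomial B :: ('v, 'k::field) mpoly) ` supported (Pow A)"
proof (intro equalityI subsetI)
  let ?e = "power_exponent B 1"
  have B: "finite B" using assms finite_subset by blast
  {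
    fix q :: "('v, 'k) mpoly" assume "q \<in> (\<lambda>p. p * squarefree_monomial B) ` supported (Pow A)"
    then obtain p where p: "p \<in> supported (Pow A)" "q = p * squarefree_monomial B" by blast
    have "B \<subseteq> Poly_Mapping.keys u \<and> Poly_Mapping.keys u \<subseteq> A" if "u \<in> Poly_Mapping.keys q" for u
    proof -
      from that obtain v where "v \<in> Poly_Mapping.keys p" "u = v + ?e"
        unfolding p(2) squarefree_monomial_def by (rule keys_mult_single)
      then show ?thesis
        using p(1) assms(2) by (auto simp: keys_add_monom keys_power_exponent[OF B] supported_def)
    qed
    then show "q \<in> supported {B..A}" by (simp add: supported_def)
  next
    fix q :: "('v, 'k) mpoly" assume q: "q \<in> supported {B..A}"
    define p where "p = (\<Sum>u\<in>Poly_Mapping.keys q. Poly_Mapping.single (u - ?e) (Poly_Mapping.lookup q u))"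
    have "u - ?e + ?e = u" if "u \<in> Poly_Mapping.keys q" for u
    proof (rule poly_mapping_eqI)
      fix v
      from q that have "B \<subseteq> Poly_Mapping.keys u" by (simp add: supported_def)
      then have "v \<in> B \<Longrightarrow> Poly_Mapping.lookup u v \<noteq> 0" by (auto simp: in_keys_iff)
      then show "Poly_Mapping.lookup (u - ?e + ?e) v = Poly_Mapping.lookup u v"
        using B by (auto simp: lookup_add lookup_minus lookup_power_exponent)
    qed
    then have "p * squarefree_monomial B =
        (\<Sum>u\<in>Poly_Mapping.keys q. Poly_Mapping.single u (Poly_Mapping.lookup q u))"
      unfolding p_def squarefree_monomial_def sum_distrib_right by (intro sum.cong) (simp_all add: mult_single)
    then have "q = p * squarefree_monomial B" by (simp add: sum_monomials)
    moreover have "p \<in> supported (Pow A)"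
      unfolding p_def
    proof (rule supported_sum)
      fix u assume "u \<in> Poly_Mapping.keys q"
      then have "Poly_Mapping.keys u \<subseteq> A" using q by (simp add: supported_def)
      moreover have "Poly_Mapping.keys (u - ?e) \<subseteq> Poly_Mapping.keys u"
        by (auto simp: in_keys_iff lookup_minus)
      ultimately show "Poly_Mapping.single (u - ?e) (Poly_Mapping.lookup q u) \<in> supported (Pow A)"
        by (auto simp: supported_def)
    qed
    ultimately show "q \<in> (\<lambda>p. p * squarefree_monomial B) ` supported (Pow A)" by blast
  }
qed

lemma squarefree_monomial_homogeneous:
  assumes "finite V" "B \<subseteq> V"
  shows "\<exists>a. (\<forall>v. v \<notin> V \<longrightarrow> a v = 0) \<and> (squarefree_monomial B :: ('v, 'k::field) mpoly) \<in> homogeneous_polys V a"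
proof -
  have "finite B" using assms finite_subset by blast
  then show ?thesis
    using assms
    by (intro exI[of _ "\<lambda>v. if v \<in> B then 1 else 0"])
      (auto simp: homogeneous_polys_def carrier_poly_ring supported_def squarefree_monomial_def
        lookup_power_exponent keys_power_exponent)
qed

section \<open>Stanley decompositions from interval partitions\<close>

lemma (in abelian_monoid) finsum_additive_map:
  assumes "f 0 = \<zero>" "\<And>p q. p \<in> P \<Longrightarrow> q \<in> P \<Longrightarrow> f (p + q) = f p \<oplus> f q"
    and "\<And>p. p \<in> P \<Longrightarrow> f p \<in> carrier G"
    and "0 \<in> P" "\<And>p q. p \<in> P \<Longrightarrow> q \<in> P \<Longrightarrow> p + q \<in> P"
    and "finite X" "\<And>i. i \<in> X \<Longrightarrow> g i \<in> P"
  shows "(\<Oplus>i\<in>X. f (g i)) = f (\<Sum>i\<in>X. g i)"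
  using assms(6,7)
proof (induction X rule: finite_induct)
  case empty
  then show ?case by (simp add: assms(1))
next
  case (insert i X)
  have "sum g X \<in> P"
    using insert.hyps(1) insert.prems
    by (induction X rule: finite_induct) (auto intro: assms(4,5))
  with insert show ?case
    by (subst finsum_insert) (auto intro!: assms(3) simp: assms(2))
qed

text \<open>
  The map \<open>\<phi>\<close> identifies the polynomials supported in \<open>\<F>\<close> with the module; it is the identity for a
  squarefree monomial ideal and the residue class map for the quotient by such an ideal, where \<open>\<F>\<close>
  consists of the supports of the monomials in, respectively outside, the ideal. Since the intervals
  partition \<open>\<F>\<close>, every polynomial is the sum of its restrictions to them and of no other family of
  polynomials supported in the respective intervals.
\<close>

lemma stanley_decomposition_of_intervals:
  fixes M :: "(('v, 'k::field) mpoly, 'b, 'v) graded_module"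
    and \<phi> :: "('v, 'k) mpoly \<Rightarrow> 'b"
  assumes M: "abelian_monoid M"
    and V: "finite V" "\<F> \<subseteq> Pow V"
    and bij: "bij_betw \<phi> (supported \<F>) (carrier M)"
    and zero: "\<phi> 0 = \<zero>\<^bsub>M\<^esub>"
    and add: "\<And>p q. p \<in> supported \<F> \<Longrightarrow> q \<in> supported \<F> \<Longrightarrow> \<phi> (p + q) = \<phi> p \<oplus>\<^bsub>M\<^esub> \<phi> q"
    and smult: "\<And>p q. p \<in> carrier (poly_ring V) \<Longrightarrow> q \<in> supported \<F> \<Longrightarrow> p * q \<in> supported \<F> \<Longrightarrow>
      p \<odot>\<^bsub>M\<^esub> \<phi> q = \<phi> (p * q)"
    and homog: "\<And>B. B \<in> \<F> \<Longrightarrow> homogeneous V M (\<phi> (squarefree_monomial B))"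
    and iv: "\<And>i. i < r \<Longrightarrow> B i \<subseteq> A i \<and> {B i..A i} \<subseteq> \<F>"
    and part: "\<And>T. T \<in> \<F> \<Longrightarrow> \<exists>!i. i < r \<and> T \<in> {B i..A i}"
  shows "stanley_decomposition V M r (\<lambda>i. \<phi> (squarefree_monomial (B i))) A"
proof -
  interpret abelian_monoid M by (rule M)
  let ?w = "\<lambda>i. squarefree_monomial (B i) :: ('v, 'k) mpoly"
  have inj: "inj_on \<phi> (supported \<F>)" and img: "\<phi> ` supported \<F> = carrier M"
    using bij by (auto simp: bij_betw_def)
  have AB: "A i \<in> \<F>" "B i \<in> \<F>" "A i \<subseteq> V" "finite (A i)" "finite (B i)" if "i < r" for i
  proof -
    show "A i \<in> \<F>" "B i \<in> \<F>" using iv[OF that] by auto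
    then show "A i \<subseteq> V" "finite (A i)" "finite (B i)" using V by (auto intro: finite_subset)
  qed
  have w: "?w i \<in> supported \<F>" if "i < r" for i
    using AB[OF that] by (simp add: squarefree_monomial_def supported_def keys_power_exponent)
  have sub: "supported {B i..A i} \<subseteq> (supported \<F> :: ('v, 'k) mpoly set)" if "i < r" for i
    using iv[OF that] by (intro supported_mono) blast
  have closed: "\<phi> p \<in> carrier M" if "i < r" "p \<in> supported {B i..A i}" for i p
    using img sub[OF that(1)] that(2) by blast
  have prod: "p * ?w i \<in> supported {B i..A i}" "p \<odot>\<^bsub>M\<^esub> \<phi> (?w i) = \<phi> (p * ?w i)"
    if "i < r" "p \<in> carrier (poly_ring (A i))" for i p
  proof -
    show 1: "p * ?w i \<in> supported {B i..A i}"
      using that AB[OF that(1)] iv[OF that(1)] by (auto simp: supported_interval carrier_poly_ring)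
    have "p \<in> carrier (poly_ring V)"
      using that AB[OF that(1)] by (auto simp: carrier_poly_ring supported_def)
    then show "p \<odot>\<^bsub>M\<^esub> \<phi> (?w i) = \<phi> (p * ?w i)"
      using 1 sub[OF that(1)] w[OF that(1)] by (intro smult) auto
  qed
  have space: "stanley_space M (\<phi> (?w i)) (A i) = \<phi> ` supported {B i..A i}" if "i < r" for i
    unfolding stanley_space_def
    using prod(2)[OF that] AB[OF that] iv[OF that]
    by (simp add: supported_interval carrier_poly_ring image_image cong: image_cong)
  have free: "inj_on (\<lambda>p. p \<odot>\<^bsub>M\<^esub> \<phi> (?w i)) (carrier (poly_ring (A i)))" if "i < r" for i
  proof (rule inj_onI)
    fix p q assume p: "p \<in> carrier (poly_ring (A i))" and q: "q \<in> carrier (poly_ring (A i))"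
      and "p \<odot>\<^bsub>M\<^esub> \<phi> (?w i) = q \<odot>\<^bsub>M\<^esub> \<phi> (?w i)"
    then have "p * ?w i = q * ?w i"
      using prod[OF that] sub[OF that] by (auto dest: inj_onD[OF inj])
    then show "p = q" using inj_mult_squarefree_monomial[of "B i"] by (auto dest: injD)
  qed
  have finsum: "(\<Oplus>\<^bsub>M\<^esub>i\<in>{..<r}. \<phi> (g i)) = \<phi> (\<Sum>i<r. g i)"
    if "\<And>i. i < r \<Longrightarrow> g i \<in> supported {B i..A i}" for g
    by (rule finsum_additive_map[where P = "supported \<F>"])
      (use that sub img in \<open>auto simp: zero add supported_add\<close>)
  have unique: "\<exists>!y. y \<in> (\<Pi>\<^sub>E i\<in>{..<r}. stanley_space M (\<phi> (?w i)) (A i)) \<and> x = finsum M y {..<r}"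
    if x: "x \<in> carrier M" for x
  proof -
    from x img obtain q where q: "q \<in> supported \<F>" "x = \<phi> q" by blast
    let ?q = "\<lambda>i. restriction {B i..A i} q"
    let ?y = "\<lambda>i\<in>{..<r}. \<phi> (?q i)"
    have "(\<Sum>i<r. ?q i) = q"
    proof (rule poly_mapping_eqI)
      fix u
      show "Poly_Mapping.lookup (\<Sum>i<r. ?q i) u = Poly_Mapping.lookup q u"
      proof (cases "Poly_Mapping.keys u \<in> \<F>")
        case True
        then obtain j where j: "j < r" "Poly_Mapping.keys u \<in> {B j..A j}"
          and j_unique: "\<And>i. i < r \<and> Poly_Mapping.keys u \<in> {B i..A i} \<Longrightarrow> i = j"
          using part[of "Poly_Mapping.keys u"] by metis
        have "Poly_Mapping.lookup (?q i) u = (if i = j then Poly_Mapping.lookup q u else 0)" if "i < r" for i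
        proof (cases "i = j")
          case True
          then show ?thesis using j by (simp add: lookup_restriction)
        next
          case False
          then have "Poly_Mapping.keys u \<notin> {B i..A i}" using j_unique[of i] that by blast
          then show ?thesis using False by (simp add: lookup_restriction del: atLeastAtMost_iff)
        qed
        then have "Poly_Mapping.lookup (\<Sum>i<r. ?q i) u = (\<Sum>i<r. if i = j then Poly_Mapping.lookup q u else 0)"
          unfolding lookup_sum by (intro sum.cong) auto
        then show ?thesis using j(1) by simp
      next
        case False
        then have "Poly_Mapping.lookup q u = 0" using q(1) by (simp add: supported_iff_lookup)
        then show ?thesis by (auto simp: lookup_sum lookup_restriction intro!: sum.neutral)
      qed
    qed
    moreover have "finsum M ?y {..<r} = (\<Oplus>\<^bsub>M\<^esub>i\<in>{..<r}. \<phi> (?q i))"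
      by (rule finsum_cong') (auto intro: closed restriction_supported)
    ultimately have 1: "x = finsum M ?y {..<r}"
      using finsum[of ?q, OF restriction_supported] q(2) by simp
    have 2: "?y \<in> (\<Pi>\<^sub>E i\<in>{..<r}. stanley_space M (\<phi> (?w i)) (A i))"
      by (auto simp: space intro!: imageI restriction_supported)
    show ?thesis
    proof (rule ex1I[of _ ?y])
      show "?y \<in> (\<Pi>\<^sub>E i\<in>{..<r}. stanley_space M (\<phi> (?w i)) (A i)) \<and> x = finsum M ?y {..<r}"
        using 1 2 by blast
    next
      fix y assume y: "y \<in> (\<Pi>\<^sub>E i\<in>{..<r}. stanley_space M (\<phi> (?w i)) (A i)) \<and> x = finsum M y {..<r}"
      then have "\<forall>i\<in>{..<r}. \<exists>p. p \<in> supported {B i..A i} \<and> y i = \<phi> p"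
        using space by (auto simp: PiE_iff)
      then obtain g where g: "\<And>i. i < r \<Longrightarrow> g i \<in> supported {B i..A i}" "\<And>i. i < r \<Longrightarrow> y i = \<phi> (g i)"
        by (metis lessThan_iff)
      have "finsum M y {..<r} = (\<Oplus>\<^bsub>M\<^esub>i\<in>{..<r}. \<phi> (g i))"
        by (rule finsum_cong') (auto simp: g(2) intro: closed g(1))
      also have "\<dots> = \<phi> (\<Sum>i<r. g i)" using finsum g(1) by blast
      finally have "finsum M y {..<r} = \<phi> (\<Sum>i<r. g i)" .
      moreover have "(\<Sum>i<r. g i) \<in> supported \<F>"
        using g(1) sub by (intro supported_sum) auto
      ultimately have sum_g: "(\<Sum>i<r. g i) = q"
        using y q by (auto dest: inj_onD[OF inj])
      have "g j = ?q j" if j: "j < r" for j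
      proof (rule poly_mapping_eqI)
        fix u
        show "Poly_Mapping.lookup (g j) u = Poly_Mapping.lookup (?q j) u"
        proof (cases "Poly_Mapping.keys u \<in> {B j..A j}")
          case True
          have "Poly_Mapping.lookup (g i) u = 0" if "i < r" "i \<noteq> j" for i
          proof -
            have "Poly_Mapping.keys u \<in> \<F>" using True iv[OF j] by blast
            then have "Poly_Mapping.keys u \<notin> {B i..A i}"
              using part[of "Poly_Mapping.keys u"] True j that by metis
            then show ?thesis using g(1)[OF that(1)] by (simp add: supported_iff_lookup)
          qed
          then have "Poly_Mapping.lookup q u = (\<Sum>i<r. if i = j then Poly_Mapping.lookup (g j) u else 0)"
            unfolding sum_g[symmetric] lookup_sum by (intro sum.cong) auto
          then show ?thesis using j True by (simp add: lookup_restriction)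
        next
          case False
          then show ?thesis using g(1)[OF j] by (simp add: lookup_restriction supported_iff_lookup del: atLeastAtMost_iff)
        qed
      qed
      then show "y = ?y"
        using y g(2) by (auto simp: PiE_iff extensional_def)
    qed
  qed
  show ?thesis
    unfolding stanley_decomposition_def
  proof (intro conjI allI impI ballI)
    fix i assume i: "i < r"
    show "\<phi> (?w i) \<in> carrier M" using img w[OF i] by blast
    show "homogeneous V M (\<phi> (?w i))" by (rule homog) (rule AB(2)[OF i])
    show "A i \<subseteq> V" by (rule AB(3)[OF i])
    show "inj_on (\<lambda>p. p \<odot>\<^bsub>M\<^esub> \<phi> (?w i)) (carrier (poly_ring (A i)))" by (rule free[OF i])
  qed (rule unique)
qed

lemma interval_partition_enumeration:
  assumes "interval_partitionable \<F> k"
  obtains r :: nat and B A where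
    "\<And>i. i < r \<Longrightarrow> B i \<subseteq> A i \<and> {B i..A i} \<subseteq> \<F>"
    "\<And>T. T \<in> \<F> \<Longrightarrow> \<exists>!i. i < r \<and> T \<in> {B i..A i}"
    "\<And>i. i < r \<Longrightarrow> k \<le> card (A i)"
proof -
  from assms obtain P where P: "finite P" "partition_on \<F> P"
    and iv: "\<forall>X\<in>P. \<exists>B A. X = {B..A} \<and> B \<subseteq> A \<and> finite A \<and> k \<le> card A"
    unfolding interval_partitionable_def by blast
  obtain f where f: "bij_betw f {..<card P} P"
    using ex_bij_betw_nat_finite[OF P(1)] by (auto simp: atLeast0LessThan)
  have "\<forall>i\<in>{..<card P}. \<exists>B A. f i = {B..A} \<and> B \<subseteq> A \<and> k \<le> card A"
    using iv f by (meson bij_betwE)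
  then obtain B A where BA: "\<And>i. i < card P \<Longrightarrow> f i = {B i..A i} \<and> B i \<subseteq> A i \<and> k \<le> card (A i)"
    by (metis lessThan_iff)
  show thesis
  proof (rule that[of "card P" B A])
    fix i assume i: "i < card P"
    then have "f i \<in> P" using f by (auto dest: bij_betwE)
    then have "f i \<subseteq> \<F>" using P(2) by (auto simp: partition_on_def)
    then show "B i \<subseteq> A i \<and> {B i..A i} \<subseteq> \<F>" "k \<le> card (A i)" using BA[OF i] by auto
  next
    fix T assume "T \<in> \<F>"
    then obtain X where X: "X \<in> P" "T \<in> X" using partition_onD1[OF P(2)] by blast
    then obtain i where i: "i < card P" "X = f i"
      using f by (auto simp: bij_betw_def)
    show "\<exists>!i. i < card P \<and> T \<in> {B i..A i}"
    proof (rule ex1I[of _ i])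
      show "i < card P \<and> T \<in> {B i..A i}" using i X(2) BA by auto
      fix j assume j: "j < card P \<and> T \<in> {B j..A j}"
      then have Tj: "T \<in> f j" "f j \<in> P" using BA f by (auto dest: bij_betwE)
      have "f j = f i"
        using partition_onD2[OF P(2)] Tj X i by (auto simp: disjoint_def)
      then show "j = i" using f i j by (auto simp: bij_betw_def dest: inj_onD)
    qed
  qed
qed

lemma stanley_decomposition_of_interval_partition:
  fixes M :: "(('v, 'k::field) mpoly, 'b, 'v) graded_module"
    and \<phi> :: "('v, 'k) mpoly \<Rightarrow> 'b"
  assumes "interval_partitionable \<F> k" "abelian_monoid M" "finite V" "\<F> \<subseteq> Pow V"
    and "bij_betw \<phi> (supported \<F>) (carrier M)"
    and "\<phi> 0 = \<zero>\<^bsub>M\<^esub>"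
    and "\<And>p q. p \<in> supported \<F> \<Longrightarrow> q \<in> supported \<F> \<Longrightarrow> \<phi> (p + q) = \<phi> p \<oplus>\<^bsub>M\<^esub> \<phi> q"
    and "\<And>p q. p \<in> carrier (poly_ring V) \<Longrightarrow> q \<in> supported \<F> \<Longrightarrow> p * q \<in> supported \<F> \<Longrightarrow>
      p \<odot>\<^bsub>M\<^esub> \<phi> q = \<phi> (p * q)"
    and "\<And>B. B \<in> \<F> \<Longrightarrow> homogeneous V M (\<phi> (squarefree_monomial B))"
  obtains r w A where "stanley_decomposition V M r w A" "\<And>i. i < r \<Longrightarrow> k \<le> card (A i)"
    "\<F> \<noteq> {} \<Longrightarrow> 0 < r"
proof (rule interval_partition_enumeration[OF assms(1)])
  fix r :: nat and B A
  assume BA: "\<And>i. i < r \<Longrightarrow> B i \<subseteq> A i \<and> {B i..A i} \<subseteq> \<F>"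
    "\<And>T. T \<in> \<F> \<Longrightarrow> \<exists>!i. i < r \<and> T \<in> {B i..A i}" "\<And>i. i < r \<Longrightarrow> k \<le> card (A i)"
  have "stanley_decomposition V M r (\<lambda>i. \<phi> (squarefree_monomial (B i))) A"
    by (rule stanley_decomposition_of_intervals[OF assms(2-9) BA(1,2)])
  moreover have "\<F> \<noteq> {} \<Longrightarrow> 0 < r" using BA(2) by (metis ex_in_conv gr_zeroI not_less_zero)
  ultimately show thesis using BA(3) that by blast
qed

section \<open>Bounding the Stanley depth by decompositions\<close>

text \<open>
  The unspecified value \<open>Min {}\<close> arises from decompositions without summands.
\<close>

lemma finite_sdepth_set:
  assumes "finite V"
  shows "finite {Min ((\<lambda>i. card (A i)) ` {..<r}) | r w A. stanley_decomposition V M r w A}" (is "finite ?S")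
proof (rule finite_subset)
  show "?S \<subseteq> insert (Min {}) {..card V}"
  proof
    fix k assume "k \<in> ?S"
    then obtain r w A where k: "k = Min ((\<lambda>i. card (A i)) ` {..<r})" and D: "stanley_decomposition V M r w A"
      by blast
    show "k \<in> insert (Min {}) {..card V}"
    proof (cases "r = 0")
      case True
      then show ?thesis by (simp add: k)
    next
      case False
      then have "card (A 0) \<le> card V"
        using D assms by (auto simp: stanley_decomposition_def intro: card_mono)
      moreover have "k \<le> card (A 0)" unfolding k using False by (intro Min_le) auto
      ultimately show ?thesis by simp
    qed
  qed
qed simp

lemma sdepth_ge:
  assumes "finite V" "stanley_decomposition V M r w A" "0 < r" "\<And>i. i < r \<Longrightarrow> k \<le> card (A i)"
  shows "k \<le> sdepth V M"
proof -
  have "k \<le> Min ((\<lambda>i. card (A i)) ` {..<r})"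
    using assms(3,4) by (subst Min_ge_iff) auto
  also have "\<dots> \<le> sdepth V M"
    unfolding sdepth_def using assms(2) by (intro Max_ge finite_sdepth_set assms(1)) blast
  finally show ?thesis .
qed

text \<open>
  One decomposition has to be given: the maximum in \<open>sdepth\<close> is unspecified on the empty set.
\<close>

lemma sdepth_le:
  assumes "finite V" "stanley_decomposition V M r w A"
    and "\<And>r w A. stanley_decomposition V M r w A \<Longrightarrow> \<exists>i<r. card (A i) \<le> k"
  shows "sdepth V M \<le> k"
  unfolding sdepth_def
proof (rule Max.boundedI[OF finite_sdepth_set[OF assms(1)]])
  show "{Min ((\<lambda>i. card (A i)) ` {..<r}) | r w A. stanley_decomposition V M r w A} \<noteq> {}"
    using assms(2) by blast
  fix l assume "l \<in> {Min ((\<lambda>i. card (A i)) ` {..<r}) | r w A. stanley_decomposition V M r w A}"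
  then obtain r w A where l: "l = Min ((\<lambda>i. card (A i)) ` {..<r})" "stanley_decomposition V M r w A"
    by blast
  with assms(3) obtain i where "i < r" "card (A i) \<le> k" by blast
  moreover from this have "l \<le> card (A i)" unfolding l(1) by (intro Min_le) auto
  ultimately show "l \<le> k" by simp
qed

section \<open>Edge ideals as spaces of polynomials\<close>

lemma uminus_poly_ring:
  assumes "p \<in> carrier (poly_ring V)"
  shows "\<ominus>\<^bsub>poly_ring V\<^esub> p = - (p :: ('v, 'k::field) mpoly)"
proof -
  interpret cring "poly_ring V :: ('v, 'k) mpoly ring" by (rule cring_poly_ring)
  show ?thesis
    by (rule minus_equality) (use assms in \<open>auto simp: poly_ring_def\<close>)
qed

lemma ideal_supported:
  assumes "\<F> \<subseteq> Pow V" "\<And>S T. S \<in> \<F> \<Longrightarrow> S \<subseteq> T \<Longrightarrow> T \<subseteq> V \<Longrightarrow> T \<in> \<F>"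
  shows "ideal (supported \<F> :: ('v, 'k::field) mpoly set) (poly_ring V)"
proof -
  interpret cring "poly_ring V :: ('v, 'k) mpoly ring" by (rule cring_poly_ring)
  have sub: "supported \<F> \<subseteq> (carrier (poly_ring V) :: ('v, 'k) mpoly set)"
    unfolding carrier_poly_ring by (rule supported_mono) (rule assms(1))
  have mult: "p * q \<in> supported \<F>" if "p \<in> supported (Pow V)" "q \<in> supported \<F>"
    for p q :: "('v, 'k) mpoly"
  proof -
    have "Poly_Mapping.keys u \<in> \<F>" if "u \<in> Poly_Mapping.keys (p * q)" for u
    proof -
      from that keys_mult[of p q] obtain a b
        where "a \<in> Poly_Mapping.keys p" "b \<in> Poly_Mapping.keys q" "u = a + b" by blast
      moreover have "Poly_Mapping.keys a \<subseteq> V" "Poly_Mapping.keys b \<in> \<F>"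
        using calculation(1,2) \<open>p \<in> _\<close> \<open>q \<in> _\<close> by (auto simp: supported_def)
      moreover from this have "Poly_Mapping.keys b \<subseteq> V" using assms(1) by blast
      ultimately show ?thesis
        using assms(2)[of "Poly_Mapping.keys b" "Poly_Mapping.keys u"] by (simp add: keys_add_monom)
    qed
    then show ?thesis by (simp add: supported_def)
  qed
  show ?thesis
  proof (rule idealI)
    show "ring (poly_ring V :: ('v, 'k) mpoly ring)" by (rule ring_axioms)
    show "subgroup (supported \<F> :: ('v, 'k) mpoly set) (add_monoid (poly_ring V))"
    proof (rule subgroup.intro)
      fix p :: "('v, 'k) mpoly" assume "p \<in> supported \<F>"
      then show "inv\<^bsub>add_monoid (poly_ring V)\<^esub> p \<in> supported \<F>"
        using sub supported_diff[of 0 \<F> p]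
        unfolding a_inv_def[symmetric] by (simp add: uminus_poly_ring subsetD)
    qed (use sub in \<open>auto simp: poly_ring_def intro: supported_add\<close>)
  next
    fix p q :: "('v, 'k) mpoly" assume "p \<in> supported \<F>" "q \<in> carrier (poly_ring V)"
    then have "q * p \<in> supported \<F>" using mult by (simp add: carrier_poly_ring)
    then show "q \<otimes>\<^bsub>poly_ring V\<^esub> p \<in> supported \<F>" "p \<otimes>\<^bsub>poly_ring V\<^esub> q \<in> supported \<F>"
      by (simp_all add: poly_ring_def mult.commute)
  qed
qed

lemma pvar_mult: "pvar x * pvar y =
    (Poly_Mapping.single (Poly_Mapping.single x 1 + Poly_Mapping.single y 1) 1 :: ('v, 'k::field) mpoly)"
  by (simp add: pvar_def mult_single)

text \<open>
  The right-hand side is an ideal that contains the generators. Conversely, a monomial whose support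
  contains an edge \<open>{x, y}\<close> is a multiple of \<open>x y\<close>.
\<close>

lemma edge_ideal_eq_supported:
  assumes "pair_graph G"
  shows "edge_ideal G = (supported (dependent_sets (pverts G) (parcs G)) :: ('v, 'k::field) mpoly set)"
    (is "_ = supported ?D")
proof
  interpret pair_graph G by fact
  interpret cring "poly_ring (pverts G) :: ('v, 'k) mpoly ring" by (rule cring_poly_ring)
  have "ideal (supported ?D :: ('v, 'k) mpoly set) (poly_ring (pverts G))"
    by (rule ideal_supported) (auto simp: dependent_sets_def)
  moreover have "(pvar x * pvar y :: ('v, 'k) mpoly) \<in> supported ?D" if "(x, y) \<in> parcs G" for x y
    using that in_arcsD1 in_arcsD2
    by (auto simp: pvar_mult supported_def keys_add_monom dependent_sets_def)
  ultimately show "edge_ideal G \<subseteq> (supported ?D :: ('v, 'k) mpoly set)"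
    unfolding edge_ideal_def by (intro genideal_minimal) auto
next
  interpret pair_graph G by fact
  interpret I: ideal "edge_ideal G :: ('v, 'k) mpoly set" "poly_ring (pverts G)"
    by (rule ideal_edge_ideal[OF assms])
  have sum_closed: "finite X \<Longrightarrow> (\<And>i. i \<in> X \<Longrightarrow> f i \<in> edge_ideal G) \<Longrightarrow> sum f X \<in> edge_ideal G"
    for X and f :: "'v monom \<Rightarrow> ('v, 'k) mpoly"
  proof (induction X rule: finite_induct)
    case empty
    then show ?case
      using additive_subgroup.zero_closed[OF I.is_additive_subgroup] by (simp add: poly_ring_def)
  next
    case (insert i X)
    then show ?case
      using additive_subgroup.a_closed[OF I.is_additive_subgroup, of "f i" "sum f X"]
      by (simp add: poly_ring_def)
  qed
  have gen: "(pvar x * pvar y :: ('v, 'k) mpoly) \<in> edge_ideal G" if "(x, y) \<in> parcs G" for x y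
    using that unfolding edge_ideal_def genideal_def by blast
  show "supported ?D \<subseteq> (edge_ideal G :: ('v, 'k) mpoly set)"
  proof
    fix p :: "('v, 'k) mpoly" assume p: "p \<in> supported ?D"
    have "Poly_Mapping.single u (Poly_Mapping.lookup p u) \<in> edge_ideal G" if "u \<in> Poly_Mapping.keys p" for u
    proof -
      from p that have "Poly_Mapping.keys u \<in> ?D" by (simp add: supported_def)
      then obtain x y where xy: "x \<in> Poly_Mapping.keys u" "y \<in> Poly_Mapping.keys u" "(x, y) \<in> parcs G"
        and u: "Poly_Mapping.keys u \<subseteq> pverts G" unfolding dependent_sets_def by blast
      have "x \<noteq> y" using xy(3) no_loops' by metis
      define e where "e = Poly_Mapping.single x (1::nat) + Poly_Mapping.single y 1"
      have ue: "u - e + e = u"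
        using xy(1,2) \<open>x \<noteq> y\<close>
        by (intro poly_mapping_eqI)
          (auto simp: e_def lookup_add lookup_minus lookup_single when_def in_keys_iff)
      have "Poly_Mapping.single (u - e) (Poly_Mapping.lookup p u) \<in> (carrier (poly_ring (pverts G)) :: ('v, 'k) mpoly set)"
      proof -
        have "Poly_Mapping.keys (u - e) \<subseteq> Poly_Mapping.keys u" by (auto simp: in_keys_iff lookup_minus)
        then show ?thesis using u by (auto simp: poly_ring_def)
      qed
      from I.I_l_closed[OF gen[OF xy(3)] this]
      show ?thesis
        using ue by (simp add: poly_ring_def pvar_mult mult_single e_def)
    qed
    from sum_closed[of "Poly_Mapping.keys p" "\<lambda>u. Poly_Mapping.single u (Poly_Mapping.lookup p u)", OF finite_keys this]
    show "p \<in> edge_ideal G" by (simp add: sum_monomials)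
  qed
qed

section \<open>Stanley depth of an edge ideal and packings of neighbourhoods\<close>

text \<open>
  The hypothesis on \<open>C\<close> says that \<open>C\<close> is a 2-packing of \<open>G\<close>. The existence of an edge makes the
  ideal nonzero, so that the decomposition has a summand.
\<close>

theorem sdepth_edge_ideal_ge:
  fixes G :: "'v pair_pre_digraph"
  assumes "pair_graph G" "parcs G \<noteq> {}" "C \<subseteq> pverts G"
    and "disjoint_family_on (\<lambda>c. insert c (parcs G `` {c})) C"
  shows "Suc (card C) \<le> sdepth (pverts G) (ideal_module (pverts G) (edge_ideal G :: ('v, 'k::field) mpoly set))"
proof -
  interpret pair_graph G by fact
  let ?V = "pverts G" and ?D = "dependent_sets (pverts G) (parcs G)"
  let ?I = "edge_ideal G :: ('v, 'k) mpoly set"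
  let ?M = "ideal_module ?V ?I"
  interpret M: Module.module "poly_ring ?V" ?M
    by (rule module_ideal_module[OF ideal_edge_ideal[OF assms(1)]])
  have I: "?I = supported ?D" by (rule edge_ideal_eq_supported[OF assms(1)])
  have "irrefl (parcs G)" unfolding irrefl_def using no_loops' by metis
  then have part: "interval_partitionable ?D (Suc (card C))"
    using assms(3,4) arcs_symmetric
    by (intro dependent_sets_partitionable) (auto simp: sym_def)
  have homog: "homogeneous ?V ?M (squarefree_monomial B)" if "B \<in> ?D" for B
  proof -
    have B: "B \<subseteq> ?V" "finite B" using that by (auto simp: dependent_sets_def intro: finite_subset)
    then have "squarefree_monomial B \<in> ?I"
      using that unfolding I by (simp add: squarefree_monomial_def supported_def keys_power_exponent)
    then show ?thesis
      using squarefree_monomial_homogeneous[OF finite_verts B(1), where 'k = 'k]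
      by (auto simp: homogeneous_def ideal_module_def)
  qed
  obtain x y where "(x, y) \<in> parcs G" using assms(2) by auto
  then have ne: "?D \<noteq> {}"
    using in_arcsD1 in_arcsD2 by (auto simp: dependent_sets_def intro!: exI[of _ "{x, y}"])
  show ?thesis
  proof (rule stanley_decomposition_of_interval_partition[where M = ?M and \<phi> = "\<lambda>p. p", OF part])
    fix r w A
    assume "stanley_decomposition ?V ?M r w A" "\<And>i. i < r \<Longrightarrow> Suc (card C) \<le> card (A i)"
      "?D \<noteq> {} \<Longrightarrow> 0 < r"
    then show ?thesis using ne by (intro sdepth_ge) auto
  next
    show "abelian_monoid ?M" by (rule M.abelian_monoid_axioms)
    show "bij_betw (\<lambda>p. p) (supported ?D) (carrier ?M)" by (simp add: I ideal_module_def bij_betw_def)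
    show "?D \<subseteq> Pow ?V" by (auto simp: dependent_sets_def)
  qed (simp_all add: homog, simp_all add: ideal_module_def)
qed

section \<open>Stanley depth of the quotient and independent dominating sets\<close>

context
  fixes V :: "'v set" and J :: "('v, 'k::field) mpoly set"
  assumes J: "ideal J (poly_ring V)"
begin

interpretation ideal J "poly_ring V" by (rule J)

interpretation coset: ring_hom_ring "poly_ring V" "poly_ring V Quot J" "\<lambda>p. J +>\<^bsub>poly_ring V\<^esub> p"
  by (rule rcos_ring_hom_ring)

lemma coset_eq_iff:
  assumes "p \<in> carrier (poly_ring V)" "q \<in> carrier (poly_ring V)"
  shows "J +>\<^bsub>poly_ring V\<^esub> p = J +>\<^bsub>poly_ring V\<^esub> q \<longleftrightarrow> p - q \<in> J"
proof -
  have "p \<ominus>\<^bsub>poly_ring V\<^esub> q = p - q"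
    using assms by (simp add: a_minus_def uminus_poly_ring)
  then show ?thesis using quotient_eq_iff_same_a_r_cos[OF J assms] by simp
qed

lemma coset_add:
  assumes "p \<in> carrier (poly_ring V)" "q \<in> carrier (poly_ring V)"
  shows "J +>\<^bsub>poly_ring V\<^esub> (p + q) =
    (J +>\<^bsub>poly_ring V\<^esub> p) \<oplus>\<^bsub>quotient_module V J\<^esub> (J +>\<^bsub>poly_ring V\<^esub> q)"
  using coset.hom_add[OF assms] by (simp add: quotient_module_def Let_def)

lemma coset_zero: "J +>\<^bsub>poly_ring V\<^esub> 0 = \<zero>\<^bsub>quotient_module V J\<^esub>"
  using coset.hom_zero by (simp add: quotient_module_def Let_def)

lemma coset_smult:
  assumes "p \<in> carrier (poly_ring V)" "q \<in> carrier (poly_ring V)"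
  shows "p \<odot>\<^bsub>quotient_module V J\<^esub> (J +>\<^bsub>poly_ring V\<^esub> q) = J +>\<^bsub>poly_ring V\<^esub> (p * q)"
  using coset.hom_mult[OF assms] by (simp add: quotient_module_def Let_def)

lemma carrier_quotient_module:
  "carrier (quotient_module V J) = (\<lambda>p. J +>\<^bsub>poly_ring V\<^esub> p) ` carrier (poly_ring V)"
  unfolding quotient_module_def Let_def FactRing_def A_RCOSETS_def' by auto

end

text \<open>
  Partition the complement of \<open>\<D>\<close> into singletons, that is, take the summands \<open>x\<^sup>T K[T]\<close> for \<open>T \<notin> \<D>\<close>.
\<close>

lemma stanley_decomposition_quotient_exists:
  fixes V :: "'v set"
  assumes "finite V" "\<D> \<subseteq> Pow V" and J: "ideal (supported \<D> :: ('v, 'k::field) mpoly set) (poly_ring V)"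
  shows "\<exists>r w A. stanley_decomposition V (quotient_module V (supported \<D> :: ('v, 'k) mpoly set)) r w A"
proof -
  let ?J = "supported \<D> :: ('v, 'k) mpoly set"
  let ?M = "quotient_module V ?J" and ?\<F> = "Pow V - \<D>"
  let ?\<phi> = "\<lambda>p. ?J +>\<^bsub>poly_ring V\<^esub> p"
  interpret M: Module.module "poly_ring V" ?M by (rule module_quotient_module[OF J])
  have sub: "p \<in> carrier (poly_ring V)" if "p \<in> supported ?\<F>" for p :: "('v, 'k) mpoly"
    using that by (auto simp: carrier_poly_ring supported_def)
  have part: "interval_partitionable ?\<F> 0"
    unfolding interval_partitionable_def
    using assms(1) partition_on_singletons[of ?\<F>]
    by (intro exI[of _ "(\<lambda>T. {T}) ` ?\<F>"]) (auto intro!: exI finite_subset[of _ V])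
  have inj: "inj_on ?\<phi> (supported ?\<F>)"
  proof (rule inj_onI)
    fix p q :: "('v, 'k) mpoly"
    assume pq: "p \<in> supported ?\<F>" "q \<in> supported ?\<F>" "?\<phi> p = ?\<phi> q"
    then have "p - q \<in> supported \<D>" using coset_eq_iff[OF J] sub by blast
    moreover have "p - q \<in> supported ?\<F>" using pq by (intro supported_diff)
    ultimately have "Poly_Mapping.keys (p - q) = {}" unfolding supported_def by auto
    then show "p = q" by simp
  qed
  have "?\<phi> p \<in> ?\<phi> ` supported ?\<F>" if p: "p \<in> carrier (poly_ring V)" for p
  proof (rule image_eqI)
    show "restriction ?\<F> p \<in> supported ?\<F>" by (rule restriction_supported)
    moreover have "p - restriction ?\<F> p \<in> supported \<D>"
      using p by (auto simp: carrier_poly_ring supported_iff_lookup lookup_minus lookup_restriction)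
    ultimately show "?\<phi> p = ?\<phi> (restriction ?\<F> p)"
      using coset_eq_iff[OF J p] sub by blast
  qed
  then have bij: "bij_betw ?\<phi> (supported ?\<F>) (carrier ?M)"
    using inj sub by (auto simp: bij_betw_def carrier_quotient_module[OF J])
  have homog: "homogeneous V ?M (?\<phi> (squarefree_monomial B))" if "B \<in> ?\<F>" for B
  proof -
    obtain a where a: "\<forall>v. v \<notin> V \<longrightarrow> a v = 0"
      "(squarefree_monomial B :: ('v, 'k) mpoly) \<in> homogeneous_polys V a"
      using squarefree_monomial_homogeneous[OF assms(1), of B, where 'k = 'k] \<open>B \<in> ?\<F>\<close> by blast
    from a(2) have "?\<phi> (squarefree_monomial B) \<in> piece ?M a"
      by (simp add: quotient_module_def Let_def)
    with a(1) show ?thesis unfolding homogeneous_def by blast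
  qed
  show ?thesis
  proof (rule stanley_decomposition_of_interval_partition[where M = ?M and \<phi> = ?\<phi>, OF part])
    show "abelian_monoid ?M" by (rule M.abelian_monoid_axioms)
  qed (use assms(1) bij homog sub in \<open>auto simp: coset_zero[OF J] coset_add[OF J] coset_smult[OF J]\<close>)
qed

text \<open>
  In every Stanley decomposition, the summand in which a high power of \<open>\<Prod>v\<in>F. v\<close> occurs is of the form
  \<open>w K[F]\<close>.
\<close>

theorem sdepth_quotient_le:
  fixes G :: "'v pair_pre_digraph"
  assumes "pair_graph G" "F \<subseteq> pverts G"
    and indep: "\<And>x y. x \<in> F \<Longrightarrow> y \<in> F \<Longrightarrow> (x, y) \<notin> parcs G"
    and dom: "\<And>v. v \<in> pverts G \<Longrightarrow> v \<notin> F \<Longrightarrow> \<exists>f\<in>F. (f, v) \<in> parcs G"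
  shows "sdepth (pverts G) (quotient_module (pverts G) (edge_ideal G :: ('v, 'k::field) mpoly set)) \<le> card F"
proof -
  interpret pair_graph G by fact
  let ?V = "pverts G" and ?D = "dependent_sets (pverts G) (parcs G)"
  let ?I = "edge_ideal G :: ('v, 'k) mpoly set"
  let ?M = "quotient_module ?V ?I" and ?S = "poly_ring ?V :: ('v, 'k) mpoly ring"
  let ?\<phi> = "\<lambda>p. ?I +>\<^bsub>?S\<^esub> p"
  have J: "ideal ?I ?S" by (rule ideal_edge_ideal[OF assms(1)])
  interpret I: ideal ?I ?S by (rule J)
  interpret M: Module.module ?S ?M by (rule module_quotient_module[OF J])
  have I: "?I = supported ?D" by (rule edge_ideal_eq_supported[OF assms(1)])
  have finF: "finite F" by (rule finite_subset[OF assms(2) finite_verts])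
  have card_le: "\<exists>i<r. card (A i) \<le> card F" if D: "stanley_decomposition ?V ?M r w A" for r w A
  proof -
    have A: "A i \<subseteq> ?V" "inj_on (\<lambda>p. p \<odot>\<^bsub>?M\<^esub> w i) (carrier (poly_ring (A i)))" if "i < r" for i
      using D that by (auto simp: stanley_decomposition_def)
    have "\<forall>i\<in>{..<r}. \<exists>a h. h \<in> homogeneous_polys ?V a \<and> w i = ?\<phi> h"
    proof
      fix i assume "i \<in> {..<r}"
      then have "homogeneous ?V ?M (w i)" using D by (simp add: stanley_decomposition_def)
      then obtain a where "w i \<in> piece ?M a" unfolding homogeneous_def by blast
      then have "w i \<in> ?\<phi> ` homogeneous_polys ?V a" by (simp add: quotient_module_def Let_def)
      then show "\<exists>a h. h \<in> homogeneous_polys ?V a \<and> w i = ?\<phi> h" by blast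
    qed
    then obtain a h where h: "\<And>i. i < r \<Longrightarrow> h i \<in> homogeneous_polys ?V (a i)" "\<And>i. i < r \<Longrightarrow> w i = ?\<phi> (h i)"
      by (metis lessThan_iff)
    have hS: "h i \<in> carrier ?S" if "i < r" for i using h(1)[OF that] by (simp add: homogeneous_polys_def)
    have pS: "p \<in> carrier ?S" if "i < r" "p \<in> carrier (poly_ring (A i))" for i p
      using that A(1) by (auto simp: carrier_poly_ring supported_def)
    have phS: "p * h i \<in> carrier ?S" if "i < r" "p \<in> carrier (poly_ring (A i))" for i p
      using I.m_closed[OF pS[OF that] hS[OF that(1)]] by (simp add: poly_ring_def)
    have smult: "p \<odot>\<^bsub>?M\<^esub> w i = ?\<phi> (p * h i)" if "i < r" "p \<in> carrier (poly_ring (A i))" for i p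
      using coset_smult[OF J pS[OF that] hS[OF that(1)]] h(2)[OF that(1)] by simp
    \<comment> \<open>\<open>t\<close> exceeds every exponent of a variable of \<open>F\<close> in a generator; the degrees are integers, hence \<open>nat\<close>.\<close>
    define t where "t = Suc (\<Sum>i<r. \<Sum>v\<in>F. nat (a i v))"
    have t: "nat (a i v) < t" if "i < r" "v \<in> F" for i v
    proof -
      have "nat (a i v) \<le> (\<Sum>v\<in>F. nat (a i v))" using that finF by (intro member_le_sum) auto
      also have "\<dots> \<le> (\<Sum>i<r. \<Sum>v\<in>F. nat (a i v))"
        using that(1) by (intro member_le_sum[of i "{..<r}" "\<lambda>i. \<Sum>v\<in>F. nat (a i v)"]) auto
      finally show ?thesis by (simp add: t_def)
    qed
    let ?\<mu> = "power_exponent F t"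
    define q :: "('v, 'k) mpoly" where "q = Poly_Mapping.single ?\<mu> 1"
    have keys_\<mu>: "Poly_Mapping.keys ?\<mu> = F" using finF by (simp add: keys_power_exponent t_def)
    have q: "q \<in> carrier ?S" using assms(2) by (simp add: q_def carrier_poly_ring supported_def keys_\<mu>)
    then have qM: "?\<phi> q \<in> carrier ?M" by (simp add: carrier_quotient_module[OF J])
    from D have "\<forall>x\<in>carrier ?M. \<exists>!y. y \<in> (\<Pi>\<^sub>E i\<in>{..<r}. stanley_space ?M (w i) (A i)) \<and> x = finsum ?M y {..<r}"
      unfolding stanley_decomposition_def by (rule conjunct2)
    from bspec[OF this qM]
    obtain y where y: "y \<in> (\<Pi>\<^sub>E i\<in>{..<r}. stanley_space ?M (w i) (A i))" "?\<phi> q = finsum ?M y {..<r}"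
      by (elim ex1E conjE)
    have "\<forall>i\<in>{..<r}. \<exists>p. p \<in> carrier (poly_ring (A i)) \<and> y i = p \<odot>\<^bsub>?M\<^esub> w i"
    proof
      fix i assume "i \<in> {..<r}"
      with y(1) have "y i \<in> stanley_space ?M (w i) (A i)" by (rule PiE_mem)
      then show "\<exists>p. p \<in> carrier (poly_ring (A i)) \<and> y i = p \<odot>\<^bsub>?M\<^esub> w i"
        unfolding stanley_space_def by (elim imageE) blast
    qed
    then obtain p where p: "\<And>i. i < r \<Longrightarrow> p i \<in> carrier (poly_ring (A i))" "\<And>i. i < r \<Longrightarrow> y i = p i \<odot>\<^bsub>?M\<^esub> w i"
      by (metis lessThan_iff)
    have "finsum ?M y {..<r} = (\<Oplus>\<^bsub>?M\<^esub>i\<in>{..<r}. ?\<phi> (p i * h i))"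
    proof (rule M.finsum_cong')
      show "(\<lambda>i. ?\<phi> (p i * h i)) \<in> {..<r} \<rightarrow> carrier ?M"
        unfolding carrier_quotient_module[OF J] using phS p(1) by blast
      show "y i = ?\<phi> (p i * h i)" if "i \<in> {..<r}" for i
        using that p smult by (simp only: lessThan_iff)
    qed simp
    also have "\<dots> = ?\<phi> (\<Sum>i<r. p i * h i)"
      by (rule M.finsum_additive_map[where P = "carrier ?S"])
        (use phS p(1) I.a_closed in \<open>simp_all add: coset_zero[OF J] coset_add[OF J] carrier_quotient_module[OF J]
           carrier_poly_ring supported_add\<close>)
    finally have "?\<phi> q = ?\<phi> (\<Sum>i<r. p i * h i)" using y(2) by simp
    moreover have "(\<Sum>i<r. p i * h i) \<in> carrier ?S"
      using phS p(1) unfolding carrier_poly_ring by (intro supported_sum) auto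
    ultimately have "q - (\<Sum>i<r. p i * h i) \<in> supported ?D"
      using coset_eq_iff[OF J q] unfolding I by blast
    moreover have "F \<notin> ?D" using indep by (auto simp: dependent_sets_def)
    ultimately have "Poly_Mapping.lookup (q - (\<Sum>i<r. p i * h i)) ?\<mu> = 0"
      using keys_\<mu> by (simp add: supported_iff_lookup)
    then have "Poly_Mapping.lookup (\<Sum>i<r. p i * h i) ?\<mu> = 1"
      by (simp add: lookup_minus q_def)
    then have "(\<Sum>i<r. Poly_Mapping.lookup (p i * h i) ?\<mu>) \<noteq> 0" by (simp add: lookup_sum)
    from sum.not_neutral_contains_not_neutral[OF this]
    obtain i where i: "i < r" "?\<mu> \<in> Poly_Mapping.keys (p i * h i)" by (auto simp: in_keys_iff)
    then obtain \<nu> u where \<nu>u: "\<nu> \<in> Poly_Mapping.keys (p i)" "u \<in> Poly_Mapping.keys (h i)" "?\<mu> = \<nu> + u"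
      using keys_mult[of "p i" "h i"] by blast
    have "F \<subseteq> A i"
    proof
      fix v assume v: "v \<in> F"
      \<comment> \<open>The generator alone cannot account for the exponent \<open>t\<close> of \<open>v\<close>.\<close>
      have "Poly_Mapping.lookup u v = nat (a i v)"
        using h(1)[OF i(1)] \<nu>u(2) by (auto simp: homogeneous_polys_def) (metis nat_int)
      then have "Poly_Mapping.lookup u v < t" using t[OF i(1) v] by simp
      moreover have "Poly_Mapping.lookup \<nu> v + Poly_Mapping.lookup u v = t"
        using \<nu>u(3) v finF by (metis lookup_add lookup_power_exponent)
      ultimately have "v \<in> Poly_Mapping.keys \<nu>" by (simp add: in_keys_iff)
      then show "v \<in> A i" using p(1)[OF i(1)] \<nu>u(1) by (auto simp: carrier_poly_ring supported_def)
    qed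
    moreover have "A i \<subseteq> F"
    proof (rule ccontr)
      assume "\<not> A i \<subseteq> F"
      then obtain v where v: "v \<in> A i" "v \<notin> F" by blast
      then obtain f where f: "f \<in> F" "(f, v) \<in> parcs G" using dom A(1)[OF i(1)] by blast
      \<comment> \<open>\<open>e\<close> is a nonzero element of \<open>K[A i]\<close> that annihilates \<open>w i\<close>.\<close>
      define e :: "('v, 'k) mpoly" where "e = pvar f * pvar v"
      have e: "e \<in> carrier (poly_ring (A i))"
        using f(1) v(1) \<open>F \<subseteq> A i\<close>
        by (auto simp: e_def pvar_mult carrier_poly_ring supported_def keys_add_monom)
      have "e \<in> ?I"
        unfolding I e_def using f(2) in_arcsD1 in_arcsD2
        by (auto simp: pvar_mult supported_def keys_add_monom dependent_sets_def)
      then have "e * h i \<in> ?I"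
        using I.I_r_closed[OF _ hS[OF i(1)], of e] by (simp add: poly_ring_def)
      then have "?\<phi> (e * h i) = ?\<phi> (0 * h i)"
        using coset_eq_iff[OF J phS[OF i(1) e], of 0] by (simp add: carrier_poly_ring)
      then have "e \<odot>\<^bsub>?M\<^esub> w i = 0 \<odot>\<^bsub>?M\<^esub> w i"
        using smult[OF i(1)] e by (simp add: carrier_poly_ring)
      then have "e = 0"
        using inj_onD[OF A(2)[OF i(1)] _ e, of 0] by (simp add: carrier_poly_ring)
      then have "Poly_Mapping.keys e = {}" by simp
      then show False by (simp add: e_def pvar_mult)
    qed
    ultimately show ?thesis using i(1) by auto
  qed
  obtain r w A where "stanley_decomposition ?V ?M r w A"
    using stanley_decomposition_quotient_exists[of ?V ?D, where 'k = 'k] J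
    unfolding I[symmetric] by (auto simp: dependent_sets_def)
  then show ?thesis using card_le by (intro sdepth_le) auto
qed

section \<open>The strong product of a cycle and a path\<close>

definition cyclically_close :: "nat \<Rightarrow> nat \<Rightarrow> nat \<Rightarrow> bool" where
  "cyclically_close n i k \<longleftrightarrow> i = k \<or> k = i + 1 \<or> i = k + 1 \<or> (i = n \<and> k = 1) \<or> (i = 1 \<and> k = n)"

lemma successor_mod_iff:
  fixes n :: nat
  assumes "2 \<le> n" "i \<in> {1..n}" "k \<in> {1..n}"
  shows "k mod n = (i + 1) mod n \<longleftrightarrow> k = i + 1 \<or> (i = n \<and> k = 1)"
proof -
  consider "i = n" | "i + 1 = n" | "i + 1 < n" using assms by fastforce
  then show ?thesis
  proof cases
    case 1
    then have "(i + 1) mod n = 1" using 1 assms by (simp add: mod_Suc)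
    then show ?thesis using 1 assms by (cases "k = n") auto
  next
    case 2
    then show ?thesis using assms by (cases "k = n") auto
  next
    case 3
    then show ?thesis using assms by (cases "k = n") auto
  qed
qed

lemma parcs_strong_cycle_path_iff:
  assumes "2 \<le> n"
  shows "((i, j), (k, l)) \<in> parcs (strong_cycle_path n m) \<longleftrightarrow>
    i \<in> {1..n} \<and> k \<in> {1..n} \<and> j \<in> {1..m} \<and> l \<in> {1..m} \<and> (i, j) \<noteq> (k, l) \<and>
    cyclically_close n i k \<and> (j = l \<or> l = j + 1 \<or> j = l + 1)"
  using successor_mod_iff[OF assms, of i k] successor_mod_iff[OF assms, of k i]
  unfolding strong_cycle_path_def strong_product_def cycle_graph_def path_graph_def cyclically_close_def
  by (simp, blast)

text \<open>
  The vertices of row \<open>1\<close> in the columns \<open>1, 4, 7, \<dots>\<close> have disjoint closed neighbourhoods: when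
  column \<open>n\<close> is read as column \<open>0\<close>, the neighbourhood of the vertex in column \<open>3 a + 1\<close> lies in the
  columns \<open>3 a, 3 a + 1, 3 a + 2\<close>.
\<close>

lemma sdepth_ideal_strong_cycle_path_ge:
  assumes "1 \<le> m" "3 \<le> n"
  shows "Suc (n div 3) \<le> sdepth (pverts (strong_cycle_path n m))
    (ideal_module (pverts (strong_cycle_path n m)) (edge_ideal (strong_cycle_path n m) :: (nat \<times> nat, 'k::field) mpoly set))"
proof -
  let ?G = "strong_cycle_path n m"
  let ?c = "\<lambda>a::nat. (3 * a + 1, 1::nat)"
  let ?C = "?c ` {..<n div 3}"
  have n: "2 \<le> n" using assms by simp
  have block: "(i mod n) div 3 = a"
    if a: "a < n div 3" and i: "i \<in> {1..n}" "cyclically_close n (3 * a + 1) i" for a i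
  proof -
    have "3 * a + 3 \<le> n" using a by linarith
    then consider "i = n" "a = 0" | "i < n" "i div 3 = a"
      using i unfolding cyclically_close_def by fastforce
    then show ?thesis by cases auto
  qed
  have nbhd: "(fst x mod n) div 3 = a"
    if "a < n div 3" "x \<in> insert (?c a) (parcs ?G `` {?c a})" for a x
  proof -
    have "3 * a + 1 \<in> {1..n}" using that(1) by auto
    then have "fst x \<in> {1..n} \<and> cyclically_close n (3 * a + 1) (fst x)"
      using that(2) by (cases x) (auto simp: parcs_strong_cycle_path_iff[OF n] cyclically_close_def)
    then show ?thesis using block that(1) by blast
  qed
  have "disjoint_family_on (\<lambda>c. insert c (parcs ?G `` {c})) ?C"
    unfolding disjoint_family_on_def
  proof (intro ballI impI)
    fix c d assume "c \<in> ?C" "d \<in> ?C" "c \<noteq> d"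
    then obtain a b where ab: "a < n div 3" "b < n div 3" "c = ?c a" "d = ?c b" "a \<noteq> b" by auto
    show "insert c (parcs ?G `` {c}) \<inter> insert d (parcs ?G `` {d}) = {}"
      using nbhd[OF ab(1)] nbhd[OF ab(2)] ab(5) unfolding ab(3,4) by (metis disjoint_iff)
  qed
  moreover have "?C \<subseteq> pverts ?G"
    using assms by (auto simp: strong_cycle_path_def strong_product_def cycle_graph_def path_graph_def)
  moreover have "((1, 1), (2, 1)) \<in> parcs ?G"
    using assms by (simp add: parcs_strong_cycle_path_iff[OF n] cyclically_close_def)
  ultimately have "Suc (card ?C) \<le> sdepth (pverts ?G) (ideal_module (pverts ?G) (edge_ideal ?G :: (nat \<times> nat, 'k) mpoly set))"
    using pair_graph_strong_cycle_path[OF assms(2)] by (intro sdepth_edge_ideal_ge) auto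
  moreover have "card ?C = n div 3" by (subst card_image) (auto simp: inj_on_def)
  ultimately show ?thesis by simp
qed

text \<open>
  The middle row (the first one if \<open>m \<le> 2\<close>) dominates every row. In it, take the columns
  \<open>1, 4, 7, \<dots>\<close>, except that the last one is moved back to column \<open>n - 1\<close> if it would be column \<open>n\<close>,
  which is adjacent to column \<open>1\<close>.
\<close>

lemma sdepth_quotient_strong_cycle_path_le:
  assumes "1 \<le> m" "m \<le> 3" "3 \<le> n"
  shows "sdepth (pverts (strong_cycle_path n m))
    (quotient_module (pverts (strong_cycle_path n m)) (edge_ideal (strong_cycle_path n m) :: (nat \<times> nat, 'k::field) mpoly set))
    \<le> (n + 2) div 3"
proof -
  let ?G = "strong_cycle_path n m"
  let ?col = "\<lambda>a. min (3 * a + 1) (n - 1)" and ?row = "(m + 1) div 2"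
  let ?F = "(\<lambda>a. (?col a, ?row)) ` {..<(n + 2) div 3}"
  have n: "2 \<le> n" using assms by simp
  have V: "pverts ?G = {1..n} \<times> {1..m}"
    by (simp add: strong_cycle_path_def strong_product_def cycle_graph_def path_graph_def)
  have m: "m = 1 \<or> m = 2 \<or> m = 3" using assms by linarith
  then have row: "?row \<in> {1..m}" by auto
  have row_dominates: "?row = l \<or> l = ?row + 1 \<or> ?row = l + 1" if "l \<in> {1..m}" for l
    using m that by (elim disjE) auto
  have col: "?col a \<in> {1..n}" for a using assms by auto
  have "?F \<subseteq> pverts ?G"
    using assms col row by (auto simp: V)
  moreover have "(x, y) \<notin> parcs ?G" if "x \<in> ?F" "y \<in> ?F" for x y
  proof -
    have apart: "\<not> cyclically_close n (?col a) (?col b) \<and> \<not> cyclically_close n (?col b) (?col a)"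
      if "a < b" "b < (n + 2) div 3" for a b
    proof -
      have "3 * a + 3 \<le> 3 * b" "3 * b \<le> n - 1" using that by linarith+
      then show ?thesis using assms unfolding cyclically_close_def by auto
    qed
    from that obtain a b where "a < (n + 2) div 3" "b < (n + 2) div 3" "x = (?col a, ?row)" "y = (?col b, ?row)"
      by blast
    then show ?thesis
      using apart[of a b] apart[of b a]
      by (cases a b rule: linorder_cases) (auto simp: parcs_strong_cycle_path_iff[OF n])
  qed
  moreover have "\<exists>f\<in>?F. (f, v) \<in> parcs ?G" if v: "v \<in> pverts ?G" "v \<notin> ?F" for v
  proof -
    obtain i l where il: "v = (i, l)" "i \<in> {1..n}" "l \<in> {1..m}" using v(1) by (auto simp: V)
    have "\<exists>a<(n + 2) div 3. cyclically_close n (?col a) i"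
    proof (cases "i = n")
      case True
      then show ?thesis using assms by (intro exI[of _ 0]) (auto simp: cyclically_close_def)
    next
      case False
      then have "i div 3 < (n + 2) div 3" using il(2) by auto
      moreover have "cyclically_close n (?col (i div 3)) i"
        using False il(2) unfolding cyclically_close_def by (auto simp: min_def)
      ultimately show ?thesis by blast
    qed
    then obtain a where a: "a < (n + 2) div 3" "cyclically_close n (?col a) i" by blast
    then have "(?col a, ?row) \<in> ?F" by blast
    moreover from this have "((?col a, ?row), v) \<in> parcs ?G"
      using a(2) il row row_dominates[OF il(3)] col[of a] v(2) unfolding il(1) parcs_strong_cycle_path_iff[OF n] by blast
    ultimately show ?thesis by blast
  qed
  ultimately have "sdepth (pverts ?G) (quotient_module (pverts ?G) (edge_ideal ?G :: (nat \<times> nat, 'k) mpoly set)) \<le> card ?F"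
    by (intro sdepth_quotient_le[OF pair_graph_strong_cycle_path[OF assms(3)]])
  also have "\<dots> \<le> (n + 2) div 3" using card_image_le[of "{..<(n + 2) div 3}"] by simp
  finally show ?thesis .
qed

theorem theorem4p9:
  fixes n m :: nat
    and I :: "(nat \<times> nat, 'k::field) mpoly set"
    and V :: "(nat \<times> nat) set"
  defines "V \<equiv> pverts (strong_cycle_path n m)"
    and "I \<equiv> edge_ideal (strong_cycle_path n m)"
  assumes "1 \<le> m" and "m \<le> 3" and "3 \<le> n"
  shows "sdepth V (ideal_module V I) \<ge> sdepth V (quotient_module V I)"
proof -
  have "sdepth V (quotient_module V I) \<le> (n + 2) div 3"
    unfolding V_def I_def using assms(3-5) by (rule sdepth_quotient_strong_cycle_path_le)
  also have "\<dots> \<le> Suc (n div 3)" by simp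
  also have "\<dots> \<le> sdepth V (ideal_module V I)"
    unfolding V_def I_def using assms(3,5) by (rule sdepth_ideal_strong_cycle_path_ge)
  finally show ?thesis .
qed

end
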